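(* Let $p$ be a prime number, $k$ a field of characteristic $p$, and $q\ge1$ an integer that is not divisible by $p$. Given $\gamma$ in $k$ such that $\gamma^q=1$, let $g(\zeta)$ be a power series in $k[[\zeta]]$ of the form $$ g(\zeta)=\gamma\zeta\left(1+\sum_{j=1}^{+\infty}a_j\zeta^{jq}\right). $$ Then $$ g^q(\zeta)\equiv\zeta\left(1+qa_1\zeta^q+q\left(\left(\frac{q^2-1}{2}\right)a_1^2+a_2\right)\zeta^{2q}\right)\mod\left\langle\zeta^{3q+1}\right\rangle. $$ Moreover, if for a given integer $n\ge1$ we put $$ \chi_{q,n}:= \begin{cases} q\,a_1^{p^n-\frac{p^n-1}{p-1}}\left(\frac{q+1}{2}a_1^2-a_2\right)^{\frac{p^n-1}{p-1}} & \text{if } p \text{ is odd};\\ a_1\left(\frac{q+1}{2}a_1^2-a_2\right) & \text{if } p=2 \text{ and } n=1;\\ a_1\left(\frac{q-1}{2}a_1^2-a_2\right)^{2^{n-1}-1}\left(\frac{q+1}{2}a_1^2-a_2\right)^{2^{n-1}} & \text{if } p=2 \text{ and } n\ge2, \end{cases} $$ and $$ \xi_{q,n}:= \begin{cases} -q\,a_1^{p^n-\frac{p^n-1}{p-1}-1}\left(\frac{q+1}{2}a_1^2-a_2\right)^{\frac{p^n-1}{p-1}+1} & \text{if } p \text{ is odd};\\ a_2^{2^{n-1}}\left(a_1^2-a_2\right)^{2^{n-1}} & \text{if } p=2, \end{cases} $$ then $$ g^{qp^n}(\zeta)\equiv\zeta\left(1+\chi_{q,n}\zeta^{q\frac{p^{n+1}-1}{p-1}}+\xi_{q,n}\zeta^{q\frac{p^{n+1}-1}{p-1}+q}\right)\mod\left\langle\zeta^{q\frac{p^{n+1}-1}{p-1}+2q+1}\right\rangle.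 $$
   Context: Powers $g^m$ of the power series $g$ denote iterates under composition. $\langle\zeta^m\rangle$ is the ideal of $k[[\zeta]]$ generated by $\zeta^m$. When $p=2$, $q$ is odd, so $\frac{q-1}{2}$, $\frac{q+1}{2}$ and $\frac{q^2-1}{2}$ are integers and define elements of $k$; when $p$ is odd, division by $2$ is in $k$. *)

theory Defs
  imports "HOL-Computational_Algebra.Computational_Algebra"
begin

definition fps_iterate :: "'a::comm_ring_1 fps \<Rightarrow> nat \<Rightarrow> 'a fps" where
  "fps_iterate g m = ((\<lambda>h. g oo h) ^^ m) fps_X"

text \<open>
  The element \<open>m/2\<close> of a field of characteristic \<open>p\<close>: for odd \<open>p\<close> the division takes place in the
  field. For \<open>p = 2\<close> it is used only for even \<open>m\<close>, where \<open>m/2\<close> is the image of an integer.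
\<close>
definition half :: "nat \<Rightarrow> nat \<Rightarrow> 'a::field" where
  "half p m = (if p = 2 then of_nat (m div 2) else of_nat m / 2)"

text \<open>
  For a prime \<open>p\<close> and \<open>n \<ge> 1\<close>, all divisions and subtractions in the exponents below are exact; in
  particular \<open>p ^ n - (p ^ n - 1) div (p - 1) \<ge> 1\<close> if \<open>p\<close> is odd.
\<close>
definition chi :: "nat \<Rightarrow> nat \<Rightarrow> nat \<Rightarrow> 'a::field \<Rightarrow> 'a \<Rightarrow> 'a" where
  "chi p q n a1 a2 =
     (if odd p then
        of_nat q * a1 ^ (p ^ n - (p ^ n - 1) div (p - 1))
          * (half p (q + 1) * a1\<^sup>2 - a2) ^ ((p ^ n - 1) div (p - 1))
      else if n = 1 then
        a1 * (half p (q + 1) * a1\<^sup>2 - a2)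
      else
        a1 * (half p (q - 1) * a1\<^sup>2 - a2) ^ (2 ^ (n - 1) - 1)
          * (half p (q + 1) * a1\<^sup>2 - a2) ^ (2 ^ (n - 1)))"

definition xi :: "nat \<Rightarrow> nat \<Rightarrow> nat \<Rightarrow> 'a::field \<Rightarrow> 'a \<Rightarrow> 'a" where
  "xi p q n a1 a2 =
     (if odd p then
        - of_nat q * a1 ^ (p ^ n - (p ^ n - 1) div (p - 1) - 1)
          * (half p (q + 1) * a1\<^sup>2 - a2) ^ ((p ^ n - 1) div (p - 1) + 1)
      else
        a2 ^ (2 ^ (n - 1)) * (a1\<^sup>2 - a2) ^ (2 ^ (n - 1)))"

text \<open>
  Infinite sums of power series are taken in the topology of the type \<open>fps\<close>. The one
  below converges, to the series with the expected coefficients.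
\<close>
lemma sums_fps_X_power_multiples:
  fixes a :: "nat \<Rightarrow> 'a::comm_ring_1"
  assumes "q \<ge> 1"
  shows "(\<lambda>j. fps_const (a (Suc j)) * fps_X ^ (Suc j * q)) sums
           Abs_fps (\<lambda>i. if i > 0 \<and> q dvd i then a (i div q) else 0)"
  unfolding sums_def
proof (rule tendsto_fpsI)
  fix i :: nat
  have "(\<Sum>j<N. fps_const (a (Suc j)) * fps_X ^ (Suc j * q)) $ i =
          (if i > 0 \<and> q dvd i then a (i div q) else 0)" if "N \<ge> i" for N
  proof -
    have "(\<Sum>j<N. fps_const (a (Suc j)) * fps_X ^ (Suc j * q)) $ i =
            (\<Sum>j<N. if i = Suc j * q then a (Suc j) else 0)"
      by (auto simp: fps_sum_nth fps_X_power_iff intro!: sum.cong simp del: mult_Suc)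
    also have "\<dots> = (if i > 0 \<and> q dvd i then a (i div q) else 0)"
    proof (cases "i > 0 \<and> q dvd i")
      case True
      then obtain l where l: "i = q * l" by blast
      with True obtain j where j: "l = Suc j" by (cases l) auto
      have eq: "i = Suc j' * q \<longleftrightarrow> j' = j" for j'
        using assms unfolding l j by (metis mult.commute mult_cancel_right nat.inject not_one_le_zero)
      have "l \<le> i" using assms l by simp
      with j that have "j < N" by simp
      moreover have "i div q = Suc j" using assms l j by simp
      ultimately show ?thesis using True unfolding eq by simp
    next
      case False
      then have "i \<noteq> Suc j * q" for j using assms by auto
      then show ?thesis using False by (auto simp del: mult_Suc)
    qed
    finally show ?thesis .
  qed
  then show "\<forall>\<^sub>F N in sequentially. (\<Sum>j<N. fps_const (a (Suc j)) * fps_X ^ (Suc j * q)) $ i =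
      Abs_fps (\<lambda>i. if i > 0 \<and> q dvd i then a (i div q) else 0) $ i"
    unfolding eventually_sequentially fps_nth_Abs_fps by blast
qed

end

theory Submission
  imports Defs "HOL-Number_Theory.Residues"
begin

text \<open>
  Since \<open>\<gamma>\<^sup>q = 1\<close>, the map \<open>\<zeta> \<mapsto> \<zeta>\<^sup>q\<close> semiconjugates \<open>g\<close> to
  \<open>h(x) = x (1 + a\<^sub>1 x + a\<^sub>2 x\<^sup>2 + \<dots>)\<^sup>q\<close>, and an iterate of \<open>g\<close> whose order is a multiple of \<open>q\<close> is
  recovered from the one of \<open>h\<close> by extracting a \<open>q\<close>-th root, which is possible because \<open>q\<close> is
  invertible in \<open>k\<close>. So it suffices to follow the two leading terms of \<open>f - id\<close> under
  \<open>f \<mapsto> f\<^sup>p\<close>, starting with \<open>f = h\<close>. In characteristic \<open>p\<close> one has \<open>f\<^sup>p = id + \<Delta>\<^sub>p\<close>,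
  where \<open>\<Delta>\<^sub>0 = id\<close> and \<open>\<Delta>\<^bsub>m+1\<^esub> = \<Delta>\<^sub>m \<circ> f - \<Delta>\<^sub>m\<close>. The first three coefficients of
  \<open>\<Delta>\<^sub>m\<close> satisfy linear recurrences in \<open>m\<close>, which are solved for \<open>m\<close> close to \<open>p\<close> with
  Wilson's theorem and the vanishing of the harmonic sum \<open>1 + 1/2 + \<dots> + 1/(p - 1)\<close> in \<open>k\<close>; the
  first coefficient vanishes at \<open>m = p\<close>, and the third coefficient of \<open>f - id\<close> cancels out.
\<close>

section \<open>Differences along the orbit of a power series\<close>

lemma fps_X_power_dvd_iff:
  fixes f :: "'a::field fps"
  shows "fps_X ^ N dvd f \<longleftrightarrow> (\<forall>i<N. f $ i = 0)"
proof (cases "f = 0")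
  case False
  then show ?thesis
    by (simp add: fps_dvd_iff fps_X_power_subdegree)
      (metis False leI less_le_trans nth_less_subdegree_zero nth_subdegree_nonzero)
qed simp

lemma fps_X_power_compose_X_mult:
  fixes R :: "'a::field fps"
  shows "(fps_X ^ N) oo (fps_X * (1 + R)) = fps_X ^ N * (1 + R) ^ N"
  by (subst fps_compose_power[symmetric]) (simp_all add: power_mult_distrib)

lemma fps_X_power_dvd_one_plus_power:
  fixes R :: "'a::field fps"
  assumes "fps_X ^ e dvd R"
  shows "fps_X ^ e dvd (1 + R) ^ N - 1"
proof -
  have "R dvd (1 + R) ^ N - 1 ^ N"
    unfolding power_diff_sumr2 by simp
  then show ?thesis using assms dvd_trans by auto
qed

text \<open>Substituting \<open>fps_X * (1 + R)\<close> for X changes X^i by X^i ((1 + R)^i - 1), a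
  gain of e in the order. This controls the truncation errors below.\<close>

lemma fps_X_power_dvd_compose_diff:
  fixes R D :: "'a::field fps"
  assumes "fps_X ^ e dvd R" and "fps_X ^ N dvd D"
  shows "fps_X ^ (N + e) dvd (D oo (fps_X * (1 + R))) - D"
proof -
  define f where "f = fps_X * (1 + R)"
  have "fps_X ^ (N + e) dvd (D oo f) - D"
    unfolding fps_X_power_dvd_iff
  proof safe
    fix n assume n: "n < N + e"
    have "D $ i * ((f ^ i - fps_X ^ i) $ n) = 0" for i
    proof (cases "i < N")
      case True
      then show ?thesis using assms(2) by (simp add: fps_X_power_dvd_iff)
    next
      case False
      have "f ^ i - fps_X ^ i = fps_X ^ i * ((1 + R) ^ i - 1)"
        by (simp only: f_def power_mult_distrib right_diff_distrib mult_1_right)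
      moreover have "fps_X ^ (i + e) dvd fps_X ^ i * ((1 + R) ^ i - 1)"
        unfolding power_add
        by (intro mult_dvd_mono dvd_refl fps_X_power_dvd_one_plus_power assms(1))
      ultimately have "(f ^ i - fps_X ^ i) $ n = 0"
        using n False unfolding fps_X_power_dvd_iff by auto
      then show ?thesis by simp
    qed
    then have "(\<Sum>i=0..n. D $ i * ((f ^ i - fps_X ^ i) $ n)) = 0"
      by (intro sum.neutral ballI)
    moreover have "((D oo f) - D) $ n = (\<Sum>i=0..n. D $ i * ((f ^ i - fps_X ^ i) $ n))"
      using fps_compose_nth[of D fps_X n] 
      by (simp add: fps_compose_nth right_diff_distrib sum_subtractf del: fps_X_power_nth)
    ultimately show "((D oo f) - D) $ n = 0" by simp
  qed
  then show ?thesis by (simp add: f_def)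
qed

text \<open>Composing with \<open>f\<close> on the right makes the operator linear in
  \<open>D\<close>; a step along the orbit is then the identity plus this operator.\<close>

definition fdiff :: "'a::field fps \<Rightarrow> nat \<Rightarrow> 'a fps" where
  "fdiff f m = ((\<lambda>D. (D oo f) - D) ^^ m) fps_X"

lemma fdiff_0 [simp]: "fdiff f 0 = fps_X"
  and fdiff_Suc: "fdiff f (Suc m) = (fdiff f m oo f) - fdiff f m"
  by (simp_all add: fdiff_def)

lemma fps_iterate_0 [simp]: "fps_iterate f 0 = fps_X"
  and fps_iterate_Suc: "fps_iterate f (Suc m) = f oo fps_iterate f m"
  by (simp_all add: fps_iterate_def)

lemma fps_iterate_nth_0:
  assumes "f $ 0 = 0"
  shows "fps_iterate f m $ 0 = 0"
  using assms by (induction m) (simp_all add: fps_iterate_Suc)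

lemma fps_iterate_add:
  fixes f :: "'a::idom fps"
  assumes "f $ 0 = 0"
  shows "fps_iterate f (m + n) = fps_iterate f m oo fps_iterate f n"
  using assms by (induction m) (simp_all add: fps_iterate_Suc fps_iterate_nth_0 fps_compose_assoc)

lemma fps_iterate_Suc_right:
  fixes f :: "'a::idom fps"
  assumes "f $ 0 = 0"
  shows "fps_iterate f (Suc m) = fps_iterate f m oo f"
  using fps_iterate_add[OF assms, of m 1] by (simp add: fps_iterate_def)

lemma fps_iterate_mult:
  fixes f :: "'a::idom fps"
  assumes "f $ 0 = 0"
  shows "fps_iterate f (m * n) = fps_iterate (fps_iterate f m) n"
  by (induction n) (simp_all add: fps_iterate_Suc fps_iterate_add assms)

text \<open>Newton's forward difference formula: right composition with \<open>f\<close> is the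
  identity plus the difference operator, so a binomial expansion applies. The induction step is
  Pascal's rule.\<close>

lemma fps_iterate_eq_sum_fdiff:
  fixes f :: "'a::field fps"
  assumes "f $ 0 = 0"
  shows "fps_iterate f m = (\<Sum>i\<le>m. of_nat (m choose i) * fdiff f i)"
proof (induction m)
  case (Suc m)
  have "fps_iterate f (Suc m) = (\<Sum>i\<le>m. of_nat (m choose i) * (fdiff f (Suc i) + fdiff f i))"
    by (simp add: fps_iterate_Suc_right assms Suc fps_compose_sum_distrib
        fps_compose_mult_distrib fdiff_Suc flip: fps_of_nat)
  also have "\<dots> = (\<Sum>i\<le>m. of_nat (m choose i) * fdiff f (Suc i)) +
                 (\<Sum>i\<le>Suc m. of_nat (m choose i) * fdiff f i)"
    by (simp add: ring_distribs sum.distrib binomial_eq_0)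
  also have "\<dots> = (\<Sum>i\<le>Suc m. of_nat (Suc m choose i) * fdiff f i)"
    unfolding sum.atMost_Suc_shift[of _ m] by (simp add: ring_distribs sum.distrib)
  finally show ?case .
qed simp

text \<open>In the binomial expansion, p divides every coefficient except the first and the
  last.\<close>

lemma fps_iterate_prime_CHAR:
  fixes f :: "'a::field fps"
  assumes "prime p" and "CHAR('a) = p" and "f $ 0 = 0"
  shows "fps_iterate f p = fps_X + fdiff f p"
proof -
  have "of_nat (p choose i) * fdiff f i = 0" if "i \<in> {..p} - {0, p}" for i
  proof -
    have "p dvd p choose i"
      using that assms(1) by (intro dvd_choose_prime) auto
    then have "of_nat (p choose i) = (0 :: 'a fps)"
      by (simp add: of_nat_eq_0_iff_char_dvd assms(2))
    then show ?thesis by simp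
  qed
  then have "fps_iterate f p = (\<Sum>i\<in>{0, p}. of_nat (p choose i) * fdiff f i)"
    unfolding fps_iterate_eq_sum_fdiff[OF assms(3)] by (intro sum.mono_neutral_right) auto
  then show ?thesis using prime_gt_0_nat[OF assms(1)] by simp
qed

text \<open>Three coefficients are tracked although the result needs two: the first one vanishes for
  the p-th difference, and the other two become the leading ones.\<close>

definition quadratic_fps :: "'a::field \<Rightarrow> 'a \<Rightarrow> 'a \<Rightarrow> 'a fps" where
  "quadratic_fps x y z = fps_const x + fps_const y * fps_X + fps_const z * fps_X\<^sup>2"

text \<open>The difference operator is linear and sends X^M to X^M ((1 + R)^M - 1); collecting
  coefficients by degree gives the recurrences. \<open>E1\<close>, \<open>E2\<close>,
  \<open>E3\<close> stay abstract so that e = 1 and e >= 3 share the argument.\<close>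

lemma fdiff_coeffs:
  fixes R :: "'a::field fps"
  assumes R: "fps_X ^ e dvd R"
    and E: "\<And>M. fps_X ^ (e + 3) dvd (1 + R) ^ M - 1 - fps_X ^ e * quadratic_fps (E1 M) (E2 M) (E3 M)"
    and c: "c 0 = 1" "\<And>m. c (Suc m) = c m * E1 (m * e + 1)"
    and d: "d 0 = 0" "\<And>m. d (Suc m) = c m * E2 (m * e + 1) + d m * E1 (m * e + 2)"
    and t: "t 0 = 0" "\<And>m. t (Suc m) =
              c m * E3 (m * e + 1) + d m * E2 (m * e + 2) + t m * E1 (m * e + 3)"
  shows "fps_X ^ (m * e + 4) dvd
           fdiff (fps_X * (1 + R)) m - fps_X ^ (m * e + 1) * quadratic_fps (c m) (d m) (t m)"
proof (induction m)
  case 0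
  then show ?case by (simp add: quadratic_fps_def c d t)
next
  case (Suc m)
  define f where "f = fps_X * (1 + R)"
  define N where "N = m * e + 1"
  define P where "P = (\<lambda>M. fps_X ^ e * quadratic_fps (E1 M) (E2 M) (E3 M))"
  define G where "G = fps_X ^ N * quadratic_fps (c m) (d m) (t m)"
  define G' where "G' = fps_X ^ (N + e) * quadratic_fps (c (Suc m)) (d (Suc m)) (t (Suc m))"
  define D where "D = fdiff f m - G"
  have f0: "f $ 0 = 0" by (simp add: f_def)
  have "fps_X ^ (N + 3) dvd D"
    using Suc.IH by (simp add: D_def G_def f_def N_def add.commute numeral_eq_Suc)
  then have "fps_X ^ (N + 3 + e) dvd (D oo f) - D"
    unfolding f_def by (intro fps_X_power_dvd_compose_diff R)
  then have D: "fps_X ^ (N + e + 3) dvd (D oo f) - D"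
    by (simp only: add_ac)
  have mono: "fps_X ^ (N + e + 3) dvd
      (fps_const x * fps_X ^ (N + j) oo f) - fps_const x * fps_X ^ (N + j)
        - fps_const x * fps_X ^ (N + j) * P (N + j)" for x j
  proof -
    have comp: "(fps_const x * fps_X ^ (N + j)) oo f
        = fps_const x * (fps_X ^ (N + j) * (1 + R) ^ (N + j))"
      by (simp only: fps_compose_mult_distrib[OF f0] fps_const_compose)
        (simp only: f_def fps_X_power_compose_X_mult)
    have "(fps_const x * fps_X ^ (N + j) oo f) - fps_const x * fps_X ^ (N + j)
        - fps_const x * fps_X ^ (N + j) * P (N + j)
       = fps_X ^ N * ((1 + R) ^ (N + j) - 1 - P (N + j)) * (fps_const x * fps_X ^ j)"
      unfolding comp by (simp add: power_add algebra_simps)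
    moreover have "fps_X ^ (N + (e + 3)) dvd fps_X ^ N * ((1 + R) ^ (N + j) - 1 - P (N + j))"
      unfolding power_add[of fps_X N] P_def by (intro mult_dvd_mono dvd_refl E)
    ultimately show ?thesis by (simp add: add.assoc)
  qed
  have G_eq: "G = fps_const (c m) * fps_X ^ (N + 0) + fps_const (d m) * fps_X ^ (N + 1)
      + fps_const (t m) * fps_X ^ (N + 2)"
    by (simp add: G_def quadratic_fps_def power_add power2_eq_square algebra_simps)
  define S where "S = fps_const (c m) * fps_X ^ (N + 0) * P (N + 0)
    + fps_const (d m) * fps_X ^ (N + 1) * P (N + 1)
    + fps_const (t m) * fps_X ^ (N + 2) * P (N + 2)"
  have "(G oo f) - G - S =
      ((fps_const (c m) * fps_X ^ (N + 0) oo f) - fps_const (c m) * fps_X ^ (N + 0)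
        - fps_const (c m) * fps_X ^ (N + 0) * P (N + 0)) +
      ((fps_const (d m) * fps_X ^ (N + 1) oo f) - fps_const (d m) * fps_X ^ (N + 1)
        - fps_const (d m) * fps_X ^ (N + 1) * P (N + 1)) +
      ((fps_const (t m) * fps_X ^ (N + 2) oo f) - fps_const (t m) * fps_X ^ (N + 2)
        - fps_const (t m) * fps_X ^ (N + 2) * P (N + 2))"
    unfolding G_eq S_def fps_compose_add_distrib by (simp only: algebra_simps)
  then have G: "fps_X ^ (N + e + 3) dvd (G oo f) - G - S"
    using mono by (simp only: dvd_add)
  have "S - G' = fps_X ^ (N + e + 3) *
      (fps_const (d m * E3 (N + 1) + t m * E2 (N + 2)) + fps_const (t m * E3 (N + 2)) * fps_X)"
    unfolding S_def G'_def P_def quadratic_fps_def c d t N_def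
    by (simp add: power_add numeral_eq_Suc algebra_simps flip: fps_const_add fps_const_mult)
  then have S: "fps_X ^ (N + e + 3) dvd S - G'" by simp
  \<comment> \<open>Three errors: the image of the remainder \<open>D\<close>, the parts of (1 +
    R)^M beyond the expansion in \<open>E\<close>, and the products that overshoot the window of
    three degrees.\<close>
  have "fdiff f (Suc m) - G' = ((D oo f) - D) + ((G oo f) - G - S) + (S - G')"
    by (simp add: fdiff_Suc D_def fps_compose_sub_distrib)
  moreover have "fps_X ^ (N + e + 3) dvd ((D oo f) - D) + ((G oo f) - G - S) + (S - G')"
    by (intro dvd_add D G S)
  moreover have "Suc m * e + 4 = N + e + 3" and "Suc m * e + 1 = N + e"
    by (simp_all add: N_def)
  ultimately show ?case
    by (simp only: f_def G'_def)
qed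

section \<open>Truncated expansions of powers of 1 + R\<close>

lemma quadratic_fps_nth:
  "quadratic_fps x y z $ i = (if i = 0 then x else if i = 1 then y else if i = 2 then z else 0)"
  by (auto simp: quadratic_fps_def fps_X_power_iff)

lemma fps_X_power_dvd_mult_cancel:
  fixes f :: "'a::field fps"
  shows "fps_X ^ (m + n) dvd fps_X ^ m * f \<longleftrightarrow> fps_X ^ n dvd f"
  by (simp add: power_add)

lemma all_less_3_nat: "(\<forall>i<3. P i) \<longleftrightarrow> P 0 \<and> P 1 \<and> P (2::nat)"
  by (auto simp: numeral_eq_Suc less_Suc_eq)

lemma all_less_4_nat: "(\<forall>i<4. P i) \<longleftrightarrow> P 0 \<and> P 1 \<and> P 2 \<and> P (3::nat)"
  by (auto simp: numeral_eq_Suc less_Suc_eq)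

lemma one_plus_power_nth:
  fixes R :: "'a::field fps"
  assumes "R $ 0 = 0"
  shows "((1 + R) ^ M) $ 0 = 1"
    and "((1 + R) ^ M) $ 1 = of_nat M * R $ 1"
    and "((1 + R) ^ M) $ 2 = of_nat M * R $ 2 + of_nat (M choose 2) * (R $ 1)\<^sup>2"
    and "((1 + R) ^ M) $ 3 = of_nat M * R $ 3
          + (2 * of_nat (M choose 2) * R $ 1 * R $ 2 + of_nat (M choose 3) * (R $ 1) ^ 3)"
proof -
  have mult: "(F * G) $ 1 = F $ 0 * G $ 1 + F $ 1 * G $ 0"
    "(F * G) $ 2 = F $ 0 * G $ 2 + F $ 1 * G $ 1 + F $ 2 * G $ 0"
    "(F * G) $ 3 = F $ 0 * G $ 3 + F $ 1 * G $ 2 + F $ 2 * G $ 1 + F $ 3 * G $ 0"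
    for F G :: "'a fps"
    by (simp_all add: fps_mult_nth numeral_eq_Suc algebra_simps)
  have choose: "Suc M choose 2 = M + (M choose 2)" "Suc M choose 3 = (M choose 2) + (M choose 3)" for M
    by (simp_all add: numeral_eq_Suc)
  have "((1 + R) ^ M) $ 0 = 1 \<and> ((1 + R) ^ M) $ 1 = of_nat M * R $ 1 \<and>
    ((1 + R) ^ M) $ 2 = of_nat M * R $ 2 + of_nat (M choose 2) * (R $ 1)\<^sup>2 \<and>
    ((1 + R) ^ M) $ 3 = of_nat M * R $ 3
          + (2 * of_nat (M choose 2) * R $ 1 * R $ 2 + of_nat (M choose 3) * (R $ 1) ^ 3)"
  proof (induction M)
    case 0
    then show ?case by (simp add: binomial_eq_0)
  next
    case (Suc M)
    then show ?case
      unfolding power_Suc mult choose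
      using assms by (simp add: algebra_simps power2_eq_square power3_eq_cube)
  qed
  then show "((1 + R) ^ M) $ 0 = 1" "((1 + R) ^ M) $ 1 = of_nat M * R $ 1"
    "((1 + R) ^ M) $ 2 = of_nat M * R $ 2 + of_nat (M choose 2) * (R $ 1)\<^sup>2"
    "((1 + R) ^ M) $ 3 = of_nat M * R $ 3
          + (2 * of_nat (M choose 2) * R $ 1 * R $ 2 + of_nat (M choose 3) * (R $ 1) ^ 3)"
    by blast+
qed

text \<open>For e = 1 the terms in R^2 and R^3 still reach the three tracked degrees, hence the
  binomial coefficients.\<close>

lemma one_plus_power_quadratic_1:
  fixes R :: "'a::field fps"
  assumes "R $ 0 = 0"
  shows "fps_X ^ (1 + 3) dvd (1 + R) ^ M - 1 - fps_X ^ 1 * quadratic_fps (of_nat M * R $ 1)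
      (of_nat M * R $ 2 + of_nat (M choose 2) * (R $ 1)\<^sup>2)
      (of_nat M * R $ 3 + (2 * of_nat (M choose 2) * R $ 1 * R $ 2 + of_nat (M choose 3) * (R $ 1) ^ 3))"
  unfolding fps_X_power_dvd_iff
  using one_plus_power_nth[OF assms, of M]
  by (simp add: all_less_4_nat quadratic_fps_nth)

lemma one_plus_power_linear:
  fixes R :: "'a::comm_ring_1"
  shows "R\<^sup>2 dvd (1 + R) ^ M - 1 - of_nat M * R"
proof (induction M)
  case (Suc M)
  have "(1 + R) ^ Suc M - 1 - of_nat (Suc M) * R
      = (1 + R) * ((1 + R) ^ M - 1 - of_nat M * R) + R\<^sup>2 * of_nat M"
    by (simp add: algebra_simps power2_eq_square)
  then show ?case using Suc by simp
qed simp

text \<open>R^2 has order at least 2 e >= e + 3, so only the term linear in R survives.\<close>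

lemma one_plus_power_quadratic_ge_3:
  fixes R :: "'a::field fps"
  assumes "e \<ge> 3" and R: "fps_X ^ (e + 3) dvd R - fps_X ^ e * quadratic_fps \<alpha> \<beta> \<rho>"
  shows "fps_X ^ (e + 3) dvd
    (1 + R) ^ M - 1 - fps_X ^ e * quadratic_fps (of_nat M * \<alpha>) (of_nat M * \<beta>) (of_nat M * \<rho>)"
proof -
  have "fps_X ^ e dvd R - fps_X ^ e * quadratic_fps \<alpha> \<beta> \<rho>"
    using R by (rule dvd_trans[rotated]) (simp add: le_imp_power_dvd)
  then have "fps_X ^ e dvd (R - fps_X ^ e * quadratic_fps \<alpha> \<beta> \<rho>) + fps_X ^ e * quadratic_fps \<alpha> \<beta> \<rho>"
    by (rule dvd_add) simp
  then have "fps_X ^ e dvd R"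
    by (simp only: diff_add_cancel)
  then have "fps_X ^ (e + e) dvd R\<^sup>2"
    unfolding power_add power2_eq_square by (intro mult_dvd_mono)
  then have "fps_X ^ (e + 3) dvd R\<^sup>2"
    using assms(1) by (elim dvd_trans[rotated]) (simp add: le_imp_power_dvd)
  then have "fps_X ^ (e + 3) dvd ((1 + R) ^ M - 1 - of_nat M * R)
      + of_nat M * (R - fps_X ^ e * quadratic_fps \<alpha> \<beta> \<rho>)"
    by (intro dvd_add dvd_mult R dvd_trans[OF _ one_plus_power_linear])
  moreover have "((1 + R) ^ M - 1 - of_nat M * R) + of_nat M * (R - fps_X ^ e * quadratic_fps \<alpha> \<beta> \<rho>)
    = (1 + R) ^ M - 1 - fps_X ^ e * quadratic_fps (of_nat M * \<alpha>) (of_nat M * \<beta>) (of_nat M * \<rho>)"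
    by (simp add: quadratic_fps_def algebra_simps flip: fps_of_nat fps_const_mult)
  ultimately show ?thesis by simp
qed

section \<open>The recurrences for the coefficients of the differences\<close>

lemma two_mult_choose_two: "2 * of_nat (n choose 2) = (of_nat n * (of_nat n - 1) :: 'a::comm_ring_1)"
proof (induction n)
  case (Suc n)
  have "Suc n choose 2 = n + (n choose 2)" by (simp add: numeral_eq_Suc)
  with Suc show ?case by (simp add: algebra_simps)
qed (simp add: binomial_eq_0)

lemma six_mult_choose_three:
  "6 * of_nat (n choose 3) = (of_nat n * (of_nat n - 1) * (of_nat n - 2) :: 'a::comm_ring_1)"
proof (induction n)
  case (Suc n)
  have "Suc n choose 3 = (n choose 2) + (n choose 3)" by (simp add: numeral_eq_Suc)
  then have "6 * of_nat (Suc n choose 3) = 3 * (2 * of_nat (n choose 2)) + (6 * of_nat (n choose 3) :: 'a)"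
    by (simp add: algebra_simps)
  also have "\<dots> = of_nat (Suc n) * (of_nat (Suc n) - 1) * (of_nat (Suc n) - 2)"
    unfolding two_mult_choose_two Suc by (simp add: algebra_simps)
  finally show ?case .
qed (simp add: binomial_eq_0)

lemma fact_CHAR_minus_one:
  assumes "prime p" and "CHAR('a::comm_ring_1) = p"
  shows "of_nat (fact (p - 1)) = (-1 :: 'a)"
proof -
  have "[fact (p - 1) = -1 :: int] (mod int p)"
    using wilson_theorem[OF assms(1)] .
  then have "int p dvd fact (p - 1) + 1"
    by (simp add: cong_iff_dvd_diff)
  then have "p dvd fact (p - 1) + 1"
    by (metis int_dvd_int_iff of_nat_1 of_nat_add of_nat_fact)
  then have "of_nat (fact (p - 1) + 1) = (0 :: 'a)"
    by (simp only: of_nat_eq_0_iff_char_dvd assms(2))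
  then show ?thesis by (simp add: eq_neg_iff_add_eq_0 add.commute)
qed

text \<open>In characteristic p, replacing i by p - i changes the sign of each reciprocal, so the
  sum is its own negative; 2 can be cancelled because p is odd.\<close>

lemma sum_inverse_below_CHAR:
  assumes "prime p" and "odd p" and "CHAR('a::field) = p"
  shows "(\<Sum>i=1..p-1. 1 / of_nat i) = (0 :: 'a)"
proof -
  have "(\<Sum>i=1..p-1. 1 / of_nat i) = (\<Sum>i=1..p-1. 1 / of_nat (p - i) :: 'a)"
    by (rule sum.reindex_bij_witness[of _ "\<lambda>i. p - i" "\<lambda>i. p - i"]) auto
  also have "\<dots> = - (\<Sum>i=1..p-1. 1 / of_nat i)"
    using assms(3) by (auto simp: of_nat_diff simp flip: sum_negf assms(3) intro!: sum.cong)
  finally have "2 * (\<Sum>i=1..p-1. 1 / of_nat i) = (0 :: 'a)"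
    by (simp add: eq_neg_iff_add_eq_0)
  moreover have "\<not> p dvd 2"
    using assms(1,2) by (metis even_numeral primes_dvd_imp_eq two_is_prime_nat)
  then have "(2 :: 'a) \<noteq> 0"
    using of_nat_eq_0_iff_char_dvd[of 2, where 'a = 'a] assms(3) by simp
  ultimately show ?thesis by simp
qed

text \<open>
  Here \<open>\<alpha>, \<beta>, \<rho>\<close> are the first three coefficients of \<open>f - id\<close>, starting at degree \<open>e + 1\<close> with
  \<open>e = 1\<close> in the field, and \<open>c m, d m, t m\<close> those of \<open>\<Delta>\<^sub>m\<close>, starting at degree \<open>m e + 1\<close>. The
  terms that are nonlinear in \<open>\<alpha>, \<beta>, \<rho>\<close> occur only if \<open>e = 1\<close>, which is encoded by \<open>l\<close>.
\<close>
context
  fixes \<alpha> \<beta> \<rho> l :: "'a::field" and c d t :: "nat \<Rightarrow> 'a"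
  assumes l: "l = 0 \<or> l = 1"
    and c: "c 0 = 1" "\<And>m. c (Suc m) = c m * (of_nat (Suc m) * \<alpha>)"
    and d: "d 0 = 0" "\<And>m. d (Suc m) = c m * (of_nat (Suc m) * \<beta> + l * (of_nat (Suc m choose 2) * \<alpha>\<^sup>2))
          + d m * (of_nat (m + 2) * \<alpha>)"
    and t: "t 0 = 0" "\<And>m. t (Suc m) = c m * (of_nat (Suc m) * \<rho>
            + l * (2 * of_nat (Suc m choose 2) * \<alpha> * \<beta> + of_nat (Suc m choose 3) * \<alpha> ^ 3))
          + d m * (of_nat (m + 2) * \<beta> + l * (of_nat (m + 2 choose 2) * \<alpha>\<^sup>2))
          + t m * (of_nat (m + 3) * \<alpha>)"
begin

lemma recurrence_c: "c m = of_nat (fact m) * \<alpha> ^ m"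
  by (induction m) (simp_all add: c algebra_simps)

lemma recurrence_small:
  shows "d 2 = \<alpha> * (2 * \<beta> + l * \<alpha>\<^sup>2) + 3 * \<alpha> * \<beta>"
    and "t 2 = \<alpha> * (2 * \<rho> + 2 * l * \<alpha> * \<beta>) + \<beta> * (3 * \<beta> + 3 * l * \<alpha>\<^sup>2) + 4 * \<alpha> * \<rho>"
  by (simp_all add: numeral_eq_Suc c d t) (simp_all add: algebra_simps)

text \<open>The prefactor (j + 2)! \<alpha>^j solves the homogeneous recurrence. Relative to it, the
  step from j adds (\<beta> - l \<alpha>^2) / (j + 3) + l \<alpha>^2 / 2, which sums to a harmonic
  number and a linear term. The bound j + 3 <= p keeps all denominators invertible.\<close>

lemma recurrence_d:
  assumes "prime p" "CHAR('a) = p" "j + 3 \<le> p"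
  shows "d (Suc j) = of_nat (fact (j + 2)) * \<alpha> ^ j *
    ((\<beta> - l * \<alpha>\<^sup>2) * ((\<Sum>i=1..j+2. 1 / of_nat i) - 1) + l * of_nat (Suc j) * \<alpha>\<^sup>2 / 2)"
  using assms(3)
proof (induction j)
  case 0
  have "\<not> p dvd 2" using 0 by (auto dest: dvd_imp_le)
  then have "(2 :: 'a) \<noteq> 0"
    using of_nat_eq_0_iff_char_dvd[of 2, where 'a = 'a] assms(2) by simp
  then show ?case by (simp add: d c binomial_eq_0 numeral_eq_Suc field_simps)
next
  case (Suc j)
  define H :: 'a where "H = (\<Sum>i=1..j+2. 1 / of_nat i)"
  have "\<not> p dvd 2" using Suc by (auto dest: dvd_imp_le)
  then have 2: "(2 :: 'a) \<noteq> 0"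
    using of_nat_eq_0_iff_char_dvd[of 2, where 'a = 'a] assms(2) by simp
  have "\<not> p dvd j + 3" using Suc by (auto dest: dvd_imp_le)
  then have 3: "of_nat (j + 3) \<noteq> (0 :: 'a)"
    using of_nat_eq_0_iff_char_dvd[of "j + 3", where 'a = 'a] assms(2) by simp
  define N :: 'a where "N = of_nat j"
  have N: "N + 3 \<noteq> 0" using 3 by (simp add: N_def)
  have H: "(\<Sum>i=1..Suc j+2. 1 / of_nat i) = H + 1 / (N + 3)"
    by (simp add: H_def N_def add_ac)
  have choose: "of_nat (Suc (Suc j) choose 2) = (N + 2) * (N + 1) / 2"
    using two_mult_choose_two[of "Suc (Suc j)", where 'a = 'a] 2
    by (simp add: N_def field_simps)
  define F :: 'a where "F = of_nat (fact (Suc j))"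
  have F: "of_nat (fact (j + 2)) = (N + 2) * F" "of_nat (fact (Suc j + 2)) = (N + 3) * (N + 2) * F"
    by (simp_all add: N_def F_def algebra_simps)
  have "d (Suc (Suc j)) = F * \<alpha> ^ Suc j * ((N + 2) * \<beta> + l * ((N + 2) * (N + 1) / 2 * \<alpha>\<^sup>2))
      + (N + 2) * F * \<alpha> ^ j * ((\<beta> - l * \<alpha>\<^sup>2) * (H - 1) + l * (N + 1) * \<alpha>\<^sup>2 / 2) * ((N + 3) * \<alpha>)"
    unfolding d(2)[of "Suc j"] choose recurrence_c F_def[symmetric] F(1)[symmetric] using Suc
    by (simp add: H_def N_def add_ac)
  also have "\<dots> = (N + 3) * (N + 2) * F * \<alpha> ^ Suc j *
      ((\<beta> - l * \<alpha>\<^sup>2) * (H + 1 / (N + 3) - 1) + l * (N + 2) * \<alpha>\<^sup>2 / 2)"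
  proof -
    \<comment> \<open>Naming the reciprocals turns the claim into a polynomial identity, up to
      multiples of the relations (N + 3) y = 1 and 2 z = 1.\<close>
    define A y z where "A = \<alpha> ^ j" and "y = 1 / (N + 3)" and "z = (1 / 2 :: 'a)"
    have "(N + 3) * y - 1 = 0" "2 * z - 1 = 0" and z: "x / 2 = x * z" for x
      using 2 N by (simp_all add: y_def z_def)
    moreover have "F * (\<alpha> * A) * ((N + 2) * \<beta> + l * ((N + 2) * (N + 1) * z * \<alpha>\<^sup>2))
      + (N + 2) * F * A * ((\<beta> - l * \<alpha>\<^sup>2) * (H - 1) + l * (N + 1) * \<alpha>\<^sup>2 * z) * ((N + 3) * \<alpha>)
      = (N + 3) * (N + 2) * F * (\<alpha> * A) * ((\<beta> - l * \<alpha>\<^sup>2) * (H + y - 1) + l * (N + 2) * \<alpha>\<^sup>2 * z)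
      - (N + 2) * F * \<alpha> * A * ((\<beta> - l * \<alpha>\<^sup>2) * ((N + 3) * y - 1) + l * \<alpha>\<^sup>2 * (2 * z - 1))"
      by (simp add: algebra_simps power2_eq_square)
    ultimately show ?thesis
      unfolding power_Suc A_def[symmetric] y_def[symmetric] z by simp
  qed
  finally show ?case unfolding H F by (simp add: N_def add_ac)
qed

text \<open>Characteristics 2 and 3 are evaluated directly, since the general argument cancels both
  2 and 3. An identity with integer coefficients gives each value up to a multiple of p.\<close>

lemma recurrence_CHAR_2:
  assumes "CHAR('a) = 2"
  shows "c 2 = 0" and "d 2 = \<alpha> * (\<beta> - l * \<alpha>\<^sup>2)" and "t 2 = \<beta> * (\<beta> - l * \<alpha>\<^sup>2)"
proof -
  have 2: "2 = (0 :: 'a)" using of_nat_CHAR[where 'a = 'a] assms by simp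
  show "c 2 = 0" by (simp add: recurrence_c 2)
  have "d 2 = \<alpha> * (\<beta> - l * \<alpha>\<^sup>2) + 2 * (2 * \<alpha> * \<beta> + l * \<alpha> * \<alpha>\<^sup>2)"
    unfolding recurrence_small by (simp add: algebra_simps)
  then show "d 2 = \<alpha> * (\<beta> - l * \<alpha>\<^sup>2)" by (simp add: 2)
  have "t 2 = \<beta> * (\<beta> - l * \<alpha>\<^sup>2) + 2 * (3 * \<alpha> * \<rho> + 3 * l * \<alpha>\<^sup>2 * \<beta> + \<beta> * \<beta>)"
    unfolding recurrence_small by (simp add: algebra_simps power2_eq_square)
  then show "t 2 = \<beta> * (\<beta> - l * \<alpha>\<^sup>2)" by (simp add: 2)
qed

lemma recurrence_CHAR_3:
  assumes "CHAR('a) = 3"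
  shows "c 3 = 0" and "d 3 = - (\<alpha>\<^sup>2 * (\<beta> - l * \<alpha>\<^sup>2))" and "t 3 = - (\<alpha> * (\<beta> - l * \<alpha>\<^sup>2)\<^sup>2)"
proof -
  have 3: "3 = (0 :: 'a)" using of_nat_CHAR[where 'a = 'a] assms by simp
  have choose: "of_nat (3 choose 2) = (3 :: 'a)" "of_nat (4 choose 2) = (6 :: 'a)"
    by (simp_all add: numeral_eq_Suc)
  have c2: "c 2 = 2 * \<alpha>\<^sup>2" by (simp add: recurrence_c)
  have "c 3 = c 2 * (3 * \<alpha>)"
    using c(2)[of 2] by (simp add: numeral_eq_Suc)
  then show "c 3 = 0" using 3 by simp
  have d3: "d 3 = c 2 * (3 * \<beta> + l * (3 * \<alpha>\<^sup>2)) + d 2 * (4 * \<alpha>)"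
    using d(2)[of 2] choose by (simp add: numeral_eq_Suc)
  have "d 3 = - (\<alpha>\<^sup>2 * (\<beta> - l * \<alpha>\<^sup>2)) + 3 * (9 * \<alpha>\<^sup>2 * \<beta> + 3 * l * \<alpha> ^ 4)"
    unfolding d3 c2 recurrence_small by (simp add: algebra_simps power2_eq_square power4_eq_xxxx)
  then show "d 3 = - (\<alpha>\<^sup>2 * (\<beta> - l * \<alpha>\<^sup>2))" by (simp add: 3)
  have t3: "t 3 = c 2 * (3 * \<rho> + l * (6 * \<alpha> * \<beta> + \<alpha> ^ 3)) + d 2 * (4 * \<beta> + l * (6 * \<alpha>\<^sup>2)) + t 2 * (5 * \<alpha>)"
    using t(2)[of 2] choose by (simp add: numeral_eq_Suc)
  \<comment> \<open>The square contains l^2, which equals l in both cases.\<close>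
  have "t 3 = - (\<alpha> * (\<beta> - l * \<alpha>\<^sup>2)\<^sup>2)
      + 3 * (12 * \<alpha>\<^sup>2 * \<rho> + 23 * l * \<alpha> ^ 3 * \<beta> + 12 * \<alpha> * \<beta>\<^sup>2 + 3 * l * \<alpha> ^ 5)"
    unfolding t3 c2 recurrence_small using l
    by (elim disjE) (simp_all add: algebra_simps power2_eq_square power3_eq_cube eval_nat_numeral)
  then show "t 3 = - (\<alpha> * (\<beta> - l * \<alpha>\<^sup>2)\<^sup>2)" by (simp add: 3)
qed

text \<open>Only indices near p matter, where n = -5 turns all coefficients into small integers. The
  closed form supplies d at p - 3. For t no closed form is needed: the factor m + 3 of
  \<open>t m\<close> vanishes at m = p - 3, so t can start at p - 2.\<close>

lemma recurrence_CHAR_ge_5: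
  assumes p: "prime p" "CHAR('a) = p" "p = n + 5"
  shows "c p = 0" and "d p = - (\<alpha> ^ (n + 4) * (\<beta> - l * \<alpha>\<^sup>2))"
    and "t p = - (\<alpha> ^ (n + 3) * (\<beta> - l * \<alpha>\<^sup>2)\<^sup>2)"
proof -
  have "odd p" using prime_odd_nat[OF p(1)] p(3) by linarith
  have *: "of_nat x \<noteq> (0 :: 'a)" if "0 < x" "x < p" for x
    using that of_nat_eq_0_iff_char_dvd[of x, where 'a = 'a] p(2) by (auto dest: dvd_imp_le)
  have 2: "(2 :: 'a) \<noteq> 0" and 3: "(3 :: 'a) \<noteq> 0"
    using *[of 2] *[of 3] p(3) by simp_all
  have n: "of_nat n = (-5 :: 'a)"
    using of_nat_CHAR[where 'a = 'a] p(2,3) by (simp add: eq_neg_iff_add_eq_0)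
  \<comment> \<open>This is (p - 3)!. Wilson's theorem gives 2 F = -1, so F serves as -1/2.\<close>
  define F :: 'a where "F = of_nat (fact (n + 2))"
  have of_nat: "of_nat (Suc (n + 2)) = (-2 :: 'a)" "of_nat (Suc (n + 3)) = (-1 :: 'a)"
    "of_nat (Suc (n + 4)) = (0 :: 'a)" "of_nat (n + 2 + 2) = (-1 :: 'a)" "of_nat (n + 3 + 2) = (0 :: 'a)"
    "of_nat (n + 4 + 2) = (1 :: 'a)" "of_nat (n + 2 + 3) = (0 :: 'a)" "of_nat (n + 3 + 3) = (1 :: 'a)"
    "of_nat (n + 4 + 3) = (2 :: 'a)"
    by (simp_all add: n)
  have Suc: "n + 3 = Suc (n + 2)" "n + 4 = Suc (n + 3)" "n + 5 = Suc (n + 4)" by simp_all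
  have step: "of_nat (fact (Suc k)) = (of_nat (Suc k) * of_nat (fact k) :: 'a)" for k
    by (simp only: fact_Suc of_nat_mult of_nat_id)
  have fact3: "of_nat (fact (n + 3)) = - 2 * F"
    unfolding Suc(1) step of_nat F_def ..
  have fact4: "of_nat (fact (n + 4)) = 2 * F"
    unfolding Suc(2) step of_nat fact3 by simp
  have fact5: "of_nat (fact (n + 5)) = (0 :: 'a)"
    unfolding Suc(3) step of_nat by simp
  have F: "2 * F = -1"
    using fact_CHAR_minus_one[OF p(1,2)] p(3) fact4 by (simp add: add.commute)
  then have fact: "of_nat (fact (n + 3)) = (1 :: 'a)" "of_nat (fact (n + 4)) = (-1 :: 'a)"
    "of_nat (fact (n + 5)) = (0 :: 'a)"
    using fact3 fact4 fact5 by simp_all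
  define A where "A = \<alpha> ^ n"
  have c_eq: "c (n + 2) = F * A * \<alpha>\<^sup>2" "c (n + 3) = A * \<alpha> ^ 3" "c (n + 4) = - A * \<alpha> ^ 4" "c (n + 5) = 0"
    unfolding recurrence_c fact F_def[symmetric] power_add A_def[symmetric]
    by simp_all
  show "c p = 0" unfolding p(3) c_eq ..
  have c2: "2 * of_nat (Suc (n + 2) choose 2) = (6 :: 'a)" "2 * of_nat (Suc (n + 3) choose 2) = (2 :: 'a)"
    "2 * of_nat (Suc (n + 4) choose 2) = (0 :: 'a)" "2 * of_nat (n + 4 + 2 choose 2) = (0 :: 'a)"
    "2 * of_nat (n + 3 + 2 choose 2) = (0 :: 'a)" "2 * of_nat (n + 2 + 2 choose 2) = (2 :: 'a)"
    unfolding two_mult_choose_two by (simp_all add: n)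
  have cancel: "x = y" if "2 * x = 2 * y" for x y :: 'a
    using that 2 by simp
  have choose2: "of_nat (Suc (n + 2) choose 2) = (3 :: 'a)" "of_nat (Suc (n + 3) choose 2) = (1 :: 'a)"
    "of_nat (Suc (n + 4) choose 2) = (0 :: 'a)" "of_nat (n + 4 + 2 choose 2) = (0 :: 'a)"
    "of_nat (n + 3 + 2 choose 2) = (0 :: 'a)" "of_nat (n + 2 + 2 choose 2) = (1 :: 'a)"
    by (rule cancel; simp only: c2; simp)+
  have c3: "6 * of_nat (Suc (n + 2) choose 3) = (-24 :: 'a)" "6 * of_nat (Suc (n + 3) choose 3) = (-6 :: 'a)"
    "6 * of_nat (Suc (n + 4) choose 3) = (0 :: 'a)"
    unfolding six_mult_choose_three by (simp_all add: n)
  have "(6 :: 'a) = 2 * 3" by simp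
  then have "(6 :: 'a) \<noteq> 0" using 2 3 mult_eq_0_iff by metis
  then have cancel: "x = y" if "6 * x = 6 * y" for x y :: 'a
    using that by simp
  have choose3: "of_nat (Suc (n + 2) choose 3) = (-4 :: 'a)" "of_nat (Suc (n + 3) choose 3) = (-1 :: 'a)"
    "of_nat (Suc (n + 4) choose 3) = (0 :: 'a)"
    by (rule cancel; simp only: c3; simp)+
  \<comment> \<open>Removing the last term 1 / (p - 1) = -1 from the vanishing harmonic sum leaves
    1, which kills the summand with \<beta> - l \<alpha>^2 in the closed form for d.\<close>
  have "(\<Sum>i=1..Suc (n + 3). 1 / of_nat i) = (0 :: 'a)"
    using sum_inverse_below_CHAR[OF p(1) \<open>odd p\<close> p(2)] p(3) by (simp add: add.commute)
  also have "(\<Sum>i=1..Suc (n + 3). 1 / of_nat i) = (\<Sum>i=1..n+3. 1 / of_nat i) + 1 / (of_nat (Suc (n + 3)) :: 'a)"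
    by (rule sum.cl_ivl_Suc[THEN trans]) simp
  finally have H: "(\<Sum>i=1..n+3. 1 / of_nat i) = (1 :: 'a)"
    unfolding of_nat by (simp add: eq_neg_iff_add_eq_0)
  have idx: "n + 1 + 2 = n + 3" "Suc (n + 1) = n + 2" by simp_all
  have "n + 1 + 3 \<le> p" using p(3) by simp
  from recurrence_d[OF p(1,2) this, unfolded idx H fact n]
  have "d (n + 2) = A * \<alpha> * (- 3 * l * \<alpha>\<^sup>2 / 2)"
    using n by (simp add: A_def mult.commute)
  moreover have "x / 2 = - (F * x)" for x
  proof -
    have "2 * - (F * x) = - (2 * F) * x" by simp
    then have "x = 2 * - (F * x)" unfolding F by simp
    then have "x / 2 = 2 * - (F * x) / 2" by (rule arg_cong)
    also have "\<dots> = - (F * x)" by (rule nonzero_mult_div_cancel_left[OF 2])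
    finally show ?thesis .
  qed
  ultimately have d2: "d (n + 2) = 3 * F * l * A * \<alpha> ^ 3"
    by (simp add: power2_eq_square power3_eq_cube)
  have "d (n + 3) = - (2 * F) * A * \<alpha>\<^sup>2 * \<beta>"
    unfolding Suc(1) d(2) choose2 of_nat c_eq d2
    by (simp add: algebra_simps power2_eq_square power3_eq_cube)
  then have d3: "d (n + 3) = A * \<alpha>\<^sup>2 * \<beta>"
    using F by simp
  have d4: "d (n + 4) = - A * \<alpha> ^ 3 * (\<beta> - l * \<alpha>\<^sup>2)"
    unfolding Suc(2) d(2) choose2 of_nat c_eq d3
    by (simp add: algebra_simps power2_eq_square power3_eq_cube)
  have "d (n + 5) = - A * \<alpha> ^ 4 * (\<beta> - l * \<alpha>\<^sup>2)"
    unfolding Suc(3) d(2) choose2 of_nat c_eq d4 by (simp add: eval_nat_numeral)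
  then show "d p = - (\<alpha> ^ (n + 4) * (\<beta> - l * \<alpha>\<^sup>2))"
    by (simp add: p(3) A_def power_add)
  have "t (n + 3) = - (2 * F) * A * \<alpha>\<^sup>2 * \<rho> + F * l * A * \<alpha> ^ 3 * (3 * \<beta> - \<alpha>\<^sup>2)"
    unfolding Suc(1) t(2) choose2 choose3 of_nat c_eq d2 using l
    by (elim disjE) (simp_all add: algebra_simps power2_eq_square power3_eq_cube)
  then have t3: "t (n + 3) = A * \<alpha>\<^sup>2 * \<rho> + F * l * A * \<alpha> ^ 3 * (3 * \<beta> - \<alpha>\<^sup>2)"
    using F by simp
  \<comment> \<open>Here \<rho> disappears: its contributions through \<open>c (n + 3)\<close> and
    \<open>t (n + 3)\<close> are opposite.\<close>
  have "t (n + 4) = l * A * \<alpha> ^ 4 * (2 * \<beta> - \<alpha>\<^sup>2) + F * l * A * \<alpha> ^ 4 * (3 * \<beta> - \<alpha>\<^sup>2)"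
    unfolding Suc(2) t(2) choose2 choose3 of_nat c_eq d3 t3
    by (simp add: algebra_simps eval_nat_numeral)
  \<comment> \<open>The next value of t uses \<open>t (n + 4)\<close> only with this factor, and the
    2 eliminates F through 2 F = -1.\<close>
  then have "t (n + 4) * (2 * \<alpha>) =
      (l * A * \<alpha> ^ 4 * (2 * \<beta> - \<alpha>\<^sup>2) + F * l * A * \<alpha> ^ 4 * (3 * \<beta> - \<alpha>\<^sup>2)) * (2 * \<alpha>)"
    by (rule arg_cong)
  also have "\<dots> = l * A * \<alpha> ^ 5 * (2 * (2 * \<beta> - \<alpha>\<^sup>2) + (2 * F) * (3 * \<beta> - \<alpha>\<^sup>2))"
    by (simp add: algebra_simps eval_nat_numeral)
  finally have t4: "t (n + 4) * (2 * \<alpha>) = l * A * \<alpha> ^ 5 * (\<beta> - \<alpha>\<^sup>2)"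
    unfolding F by (simp add: algebra_simps)
  have "t (n + 5) = - A * \<alpha> ^ 3 * (\<beta> - l * \<alpha>\<^sup>2)\<^sup>2"
    unfolding Suc(3) t(2) choose2 choose3 of_nat c_eq d4 t4 using l
    by (elim disjE) (simp_all add: algebra_simps eval_nat_numeral)
  then show "t p = - (\<alpha> ^ (n + 3) * (\<beta> - l * \<alpha>\<^sup>2)\<^sup>2)"
    by (simp add: p(3) A_def power_add)
qed

end

section \<open>The leading terms of iterates\<close>

text \<open>A congruence, not a statement about exact orders: x and y may vanish, so degenerate
  coefficients need no separate treatment.\<close>

definition leading_terms :: "'a::field fps \<Rightarrow> nat \<Rightarrow> 'a \<Rightarrow> 'a \<Rightarrow> bool" where
  "leading_terms f e x y \<longleftrightarrow>
     fps_X ^ (e + 3) dvd f - fps_X * (1 + fps_const x * fps_X ^ e + fps_const y * fps_X ^ (e + 1))"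

lemma leading_terms_nth_0:
  assumes "leading_terms f e x y"
  shows "f $ 0 = 0"
  using assms[unfolded leading_terms_def fps_X_power_dvd_iff, rule_format, of 0] by simp

lemma fps_eq_X_mult_one_plus:
  fixes f :: "'a::field fps"
  assumes "f $ 0 = 0"
  obtains R where "f = fps_X * (1 + R)"
proof
  show "f = fps_X * (1 + (fps_shift 1 f - 1))"
    using assms by (auto simp: fps_eq_iff)
qed

lemma leading_terms_X_mult_iff:
  "leading_terms (fps_X * (1 + R)) e x y \<longleftrightarrow> fps_X ^ (e + 2) dvd R - fps_X ^ e * quadratic_fps x y 0"
proof -
  have "fps_X * (1 + R) - fps_X * (1 + fps_const x * fps_X ^ e + fps_const y * fps_X ^ (e + 1))
      = fps_X ^ 1 * (R - fps_X ^ e * quadratic_fps x y 0)"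
    by (simp add: quadratic_fps_def algebra_simps)
  moreover have "e + 3 = 1 + (e + 2)" by simp
  ultimately show ?thesis
    unfolding leading_terms_def by (simp only: fps_X_power_dvd_mult_cancel)
qed

text \<open>\<open>leading_terms\<close> leaves the third coefficient free; the recurrences carry it
  as an unknown until it cancels.\<close>

lemma fps_X_power_dvd_quadratic_fps:
  fixes R :: "'a::field fps"
  assumes "fps_X ^ (e + 2) dvd R - fps_X ^ e * quadratic_fps x y 0"
  shows "fps_X ^ (e + 3) dvd R - fps_X ^ e * quadratic_fps x y (R $ (e + 2))"
  unfolding fps_X_power_dvd_iff
proof safe
  fix i assume i: "i < e + 3"
  show "(R - fps_X ^ e * quadratic_fps x y (R $ (e + 2))) $ i = 0"
  proof (cases "i = e + 2")
    case True
    then show ?thesis by (simp add: fps_X_power_mult_nth quadratic_fps_nth)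
  next
    case False
    with i have "(R - fps_X ^ e * quadratic_fps x y 0) $ i = 0"
      using assms unfolding fps_X_power_dvd_iff by simp
    then show ?thesis using i False
      by (simp add: fps_X_power_mult_nth quadratic_fps_nth split: if_splits)
  qed
qed

text \<open>The first coefficient of the p-th difference vanishes, so the leading terms move one
  degree up, to the exponent p e + 1. As e is 1 in the field, m e + j becomes m + j in the linear
  terms; binomial coefficients occur only for e = 1, where this is literal. For e = 2, R^2 would
  reach the third coefficient, but the exponents 1, p + 1, ... skip that value.\<close>

lemma leading_terms_iterate_CHAR:
  fixes f :: "'a::field fps"
  assumes p: "prime p" "CHAR('a) = p"
    and l: "e = 1 \<and> l = 1 \<or> e \<ge> 3 \<and> l = 0"
    and e: "of_nat e = (1 :: 'a)"
    and f: "leading_terms f e \<alpha> \<beta>"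
  shows "leading_terms (fps_iterate f p) (p * e + 1) (- (\<alpha> ^ (p - 1) * (\<beta> - l * \<alpha>\<^sup>2)))
    (if p = 2 then \<beta> * (\<beta> - l * \<alpha>\<^sup>2) else - (\<alpha> ^ (p - 2) * (\<beta> - l * \<alpha>\<^sup>2)\<^sup>2))"
proof -
  obtain R where fR: "f = fps_X * (1 + R)"
    using fps_eq_X_mult_one_plus leading_terms_nth_0[OF f] by blast
  define \<rho> where "\<rho> = R $ (e + 2)"
  have R: "fps_X ^ (e + 3) dvd R - fps_X ^ e * quadratic_fps \<alpha> \<beta> \<rho>"
    using f unfolding fR leading_terms_X_mult_iff \<rho>_def by (rule fps_X_power_dvd_quadratic_fps)
  have R_nth: "R $ i = (if i < e then 0 else quadratic_fps \<alpha> \<beta> \<rho> $ (i - e))" if "i < e + 3" for i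
    using R that unfolding fps_X_power_dvd_iff by (simp add: fps_X_power_mult_nth)
  then have Re: "fps_X ^ e dvd R"
    by (simp add: fps_X_power_dvd_iff)
  define E1 :: "nat \<Rightarrow> 'a" where "E1 = (\<lambda>M. of_nat M * \<alpha>)"
  define E2 where "E2 = (\<lambda>M. of_nat M * \<beta> + l * (of_nat (M choose 2) * \<alpha>\<^sup>2))"
  define E3 where "E3 = (\<lambda>M. of_nat M * \<rho>
      + l * (2 * of_nat (M choose 2) * \<alpha> * \<beta> + of_nat (M choose 3) * \<alpha> ^ 3))"
  have E: "fps_X ^ (e + 3) dvd (1 + R) ^ M - 1 - fps_X ^ e * quadratic_fps (E1 M) (E2 M) (E3 M)" for M
    using l
  proof
    assume 1: "e = 1 \<and> l = 1"
    then have "R $ 0 = 0" "R $ 1 = \<alpha>" "R $ 2 = \<beta>" "R $ 3 = \<rho>"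
      using R_nth[of 0] R_nth[of 1] R_nth[of 2] R_nth[of 3] by (simp_all add: quadratic_fps_nth)
    then show ?thesis
      using one_plus_power_quadratic_1[of R M] 1 unfolding E1_def E2_def E3_def by simp
  next
    assume "e \<ge> 3 \<and> l = 0"
    then show ?thesis
      using one_plus_power_quadratic_ge_3[OF _ R, of M] unfolding E1_def E2_def E3_def by simp
  qed
  define cdt :: "nat \<Rightarrow> 'a \<times> 'a \<times> 'a" where
    "cdt = rec_nat (1, 0, 0) (\<lambda>m (c, d, t). (c * E1 (m * e + 1),
       c * E2 (m * e + 1) + d * E1 (m * e + 2),
       c * E3 (m * e + 1) + d * E2 (m * e + 2) + t * E1 (m * e + 3)))"
  define c d t where "c = fst \<circ> cdt" and "d = fst \<circ> snd \<circ> cdt" and "t = snd \<circ> snd \<circ> cdt"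
  have c: "c 0 = 1" "\<And>m. c (Suc m) = c m * E1 (m * e + 1)"
    and d: "d 0 = 0" "\<And>m. d (Suc m) = c m * E2 (m * e + 1) + d m * E1 (m * e + 2)"
    and t: "t 0 = 0" "\<And>m. t (Suc m) =
              c m * E3 (m * e + 1) + d m * E2 (m * e + 2) + t m * E1 (m * e + 3)"
    by (simp_all add: c_def d_def t_def cdt_def split: prod.split)
  have fdiff: "fps_X ^ (p * e + 4) dvd fdiff f p - fps_X ^ (p * e + 1) * quadratic_fps (c p) (d p) (t p)"
    unfolding fR by (rule fdiff_coeffs[OF Re E c d t])
  have E_mod: "E1 (m * e + j) = of_nat (m + j) * \<alpha>"
    "E2 (m * e + j) = of_nat (m + j) * \<beta> + l * (of_nat (m + j choose 2) * \<alpha>\<^sup>2)"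
    "E3 (m * e + j) = of_nat (m + j) * \<rho>
      + l * (2 * of_nat (m + j choose 2) * \<alpha> * \<beta> + of_nat (m + j choose 3) * \<alpha> ^ 3)" for m j
    unfolding E1_def E2_def E3_def using l e by auto
  have l01: "l = 0 \<or> l = 1" using l by auto
  note c' = c[unfolded E_mod, unfolded Suc_eq_plus1[symmetric]]
  note d' = d[unfolded E_mod, unfolded Suc_eq_plus1[symmetric]]
  note t' = t[unfolded E_mod, unfolded Suc_eq_plus1[symmetric]]
  consider "p = 2" | "p = 3" | n where "p = n + 5"
  proof -
    have "p \<noteq> 4" using p(1) prime_odd_nat[of 4] by auto
    moreover have "p \<ge> 2" using p(1) by (rule prime_ge_2_nat)
    moreover have "p = (p - 5) + 5" if "p \<ge> 5" using that by simp
    ultimately show ?thesis using that by fastforce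
  qed
  then have cdt_p: "c p = 0 \<and> d p = - (\<alpha> ^ (p - 1) * (\<beta> - l * \<alpha>\<^sup>2)) \<and>
    t p = (if p = 2 then \<beta> * (\<beta> - l * \<alpha>\<^sup>2) else - (\<alpha> ^ (p - 2) * (\<beta> - l * \<alpha>\<^sup>2)\<^sup>2))"
  proof cases
    case 1
    have "2 = (0 :: 'a)" using of_nat_CHAR[where 'a = 'a] p(2) 1 by simp
    then show ?thesis
      using recurrence_CHAR_2[OF l01 c' d' t'] p(2) 1 by simp
  next
    case 2
    then show ?thesis
      using recurrence_CHAR_3[OF l01 c' d' t'] p(2) by simp
  next
    case 3
    then show ?thesis
      using recurrence_CHAR_ge_5[OF l01 c' d' t' p 3] by (simp add: numeral_eq_Suc)
  qed
  have "fps_iterate f p - fps_X * (1 + fps_const (d p) * fps_X ^ (p * e + 1)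
      + fps_const (t p) * fps_X ^ (p * e + 1 + 1))
      = fdiff f p - fps_X ^ (p * e + 1) * quadratic_fps (c p) (d p) (t p)"
    unfolding fps_iterate_prime_CHAR[OF p leading_terms_nth_0[OF f]]
    using cdt_p by (simp add: quadratic_fps_def algebra_simps power2_eq_square)
  moreover have "p * e + 4 = p * e + 1 + 3" by simp
  ultimately have "leading_terms (fps_iterate f p) (p * e + 1) (d p) (t p)"
    unfolding leading_terms_def using fdiff by (simp only:)
  then show ?thesis using cdt_p by simp
qed

text \<open>Cross terms in a composition have order at least 2 e + 1 >= e + 3, so the two
  coefficients simply add up.\<close>

lemma leading_terms_iterate:
  fixes f :: "'a::field fps"
  assumes "e \<ge> 2" and f: "leading_terms f e x y"
  shows "leading_terms (fps_iterate f m) e (of_nat m * x) (of_nat m * y)"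
proof (induction m)
  case 0
  then show ?case by (simp add: leading_terms_def)
next
  case (Suc m)
  note f0 = leading_terms_nth_0[OF f]
  obtain R where fR: "f = fps_X * (1 + R)"
    using fps_eq_X_mult_one_plus f0 by blast
  define D where "D = fps_iterate f m - fps_X"
  define S where "S = (\<lambda>x y :: 'a. fps_const x * fps_X ^ e + fps_const y * fps_X ^ (e + 1))"
  have IH: "fps_X ^ (e + 3) dvd D - fps_X * S (of_nat m * x) (of_nat m * y)"
    using Suc by (simp add: leading_terms_def D_def S_def algebra_simps)
  have f': "fps_X ^ (e + 3) dvd f - fps_X * (1 + S x y)"
    using f by (simp add: leading_terms_def S_def algebra_simps)
  have "fps_X ^ e dvd S x y" for x y by (simp add: S_def)
  then have XS: "fps_X ^ (e + 1) dvd fps_X * S x y" for x y by simp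
  have "fps_X ^ (e + 1) dvd fps_X ^ (e + 3)" by (rule le_imp_power_dvd) simp
  then have "fps_X ^ (e + 1) dvd
      (D - fps_X * S (of_nat m * x) (of_nat m * y)) + fps_X * S (of_nat m * x) (of_nat m * y)"
    using IH XS by (intro dvd_add) (rule dvd_trans)
  then have D: "fps_X ^ (e + 1) dvd D" by (simp only: diff_add_cancel)
  have "fps_X ^ e dvd R"
  proof -
    have "fps_X ^ (e + 2) dvd R - fps_X ^ e * quadratic_fps x y 0"
      using f unfolding fR leading_terms_X_mult_iff .
    then have "fps_X ^ e dvd R - fps_X ^ e * quadratic_fps x y 0"
      by (rule dvd_trans[rotated]) (simp add: le_imp_power_dvd)
    then have "fps_X ^ e dvd (R - fps_X ^ e * quadratic_fps x y 0) + fps_X ^ e * quadratic_fps x y 0"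
      by (rule dvd_add) simp
    then show ?thesis by (simp only: diff_add_cancel)
  qed
  then have "fps_X ^ (e + 1 + e) dvd (D oo f) - D"
    unfolding fR using D by (rule fps_X_power_dvd_compose_diff)
  then have "fps_X ^ (e + 3) dvd (D oo f) - D"
    using assms(1) by (elim dvd_trans[rotated]) (simp add: le_imp_power_dvd del: power_Suc)
  then have "fps_X ^ (e + 3) dvd ((D oo f) - D) + (D - fps_X * S (of_nat m * x) (of_nat m * y))
      + (f - fps_X * (1 + S x y))"
    by (intro dvd_add IH f')
  also have "((D oo f) - D) + (D - fps_X * S (of_nat m * x) (of_nat m * y)) + (f - fps_X * (1 + S x y))
    = fps_iterate f (Suc m) - fps_X * (1 + S (of_nat (Suc m) * x) (of_nat (Suc m) * y))"
    by (simp add: fps_iterate_Suc_right[OF f0] D_def S_def fps_compose_sub_distrib f0 algebra_simps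
        flip: fps_const_add)
  finally show ?case by (simp add: leading_terms_def S_def algebra_simps)
qed

lemma leading_terms_1_iff:
  "leading_terms f 1 x y \<longleftrightarrow> f $ 0 = 0 \<and> f $ 1 = 1 \<and> f $ 2 = x \<and> f $ 3 = y"
proof -
  have "fps_X * (1 + fps_const x * fps_X ^ 1 + fps_const y * fps_X ^ (1 + 1))
      = fps_X + fps_const x * fps_X ^ 2 + fps_const y * fps_X ^ 3"
    by (simp add: algebra_simps power2_eq_square power3_eq_cube)
  moreover have "1 + 3 = (4 :: nat)" by simp
  ultimately show ?thesis
    unfolding leading_terms_def fps_X_power_dvd_iff by (simp only:) (simp add: all_less_4_nat)
qed

text \<open>For e = 1 the cross terms are visible: composing the m-th iterate with \<open>f\<close>
  adds 2 m x^2 to the cubic coefficient, and these contributions sum to m (m - 1) x^2.\<close>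

lemma leading_terms_iterate_1:
  fixes f :: "'a::field fps"
  assumes f: "leading_terms f 1 x y"
  shows "leading_terms (fps_iterate f m) 1 (of_nat m * x) (of_nat m * y + of_nat m * (of_nat m - 1) * x\<^sup>2)"
proof (induction m)
  case 0
  then show ?case by (simp add: leading_terms_def)
next
  case (Suc m)
  note f0 = leading_terms_nth_0[OF f]
  have mult: "(F * G) $ 1 = F $ 0 * G $ 1 + F $ 1 * G $ 0"
    "(F * G) $ 2 = F $ 0 * G $ 2 + F $ 1 * G $ 1 + F $ 2 * G $ 0"
    "(F * G) $ 3 = F $ 0 * G $ 3 + F $ 1 * G $ 2 + F $ 2 * G $ 1 + F $ 3 * G $ 0"
    for F G :: "'a fps"
    by (simp_all add: fps_mult_nth numeral_eq_Suc algebra_simps)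
  have compose: "(F oo G) $ 1 = F $ 1 * G $ 1"
    "(F oo G) $ 2 = F $ 1 * G $ 2 + F $ 2 * (G ^ 2) $ 2"
    "(F oo G) $ 3 = F $ 1 * G $ 3 + F $ 2 * (G ^ 2) $ 3 + F $ 3 * (G ^ 3) $ 3"
    for F G :: "'a fps"
    by (simp_all add: fps_compose_nth numeral_eq_Suc)
  show ?case
    using Suc f unfolding leading_terms_1_iff fps_iterate_Suc_right[OF f0] compose
    unfolding power2_eq_square power3_eq_cube mult
    by (simp add: algebra_simps)
qed

section \<open>Semiconjugation by a power\<close>

lemma fps_compose_X_power_mult_distrib:
  fixes f g :: "'a::idom fps"
  assumes "q \<ge> 1"
  shows "(f * g) oo fps_X ^ q = (f oo fps_X ^ q) * (g oo fps_X ^ q)"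
  using assms by (intro fps_compose_mult_distrib) (simp add: fps_X_power_iff)

text \<open>One series v governs both iterates and is updated to \<open>v * (u oo H)\<close>, with H
  the current iterate of \<open>h\<close>. This works because the q-th power of the iterate of
  \<open>g\<close> is \<open>H oo fps_X ^ q\<close>, which uses \<gamma>^q = 1. The normalisation
  \<open>v $ 0 = 1\<close> selects the q-th root.\<close>

lemma fps_iterate_semiconjugate:
  fixes u :: "'a::field fps"
  assumes q: "q \<ge> 1" and \<gamma>: "\<gamma> ^ q = 1" and u: "u $ 0 = 1"
    and g: "g = fps_const \<gamma> * fps_X * (u oo fps_X ^ q)" and h: "h = fps_X * u ^ q"
  obtains v where "v $ 0 = 1" "fps_iterate h m = fps_X * v ^ q"
    "fps_iterate g m = fps_const (\<gamma> ^ m) * fps_X * (v oo fps_X ^ q)"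
proof -
  have X0: "(fps_X ^ q) $ 0 = (0 :: 'a)" using q by simp
  have XX: "fps_X oo fps_X ^ q = (fps_X ^ q :: 'a fps)"
    by (rule fps_X_fps_compose_startby0[OF X0])
  have "\<exists>v. v $ 0 = 1 \<and> fps_iterate h m = fps_X * v ^ q \<and>
    fps_iterate g m = fps_const (\<gamma> ^ m) * fps_X * (v oo fps_X ^ q)"
  proof (induction m)
    case 0
    show ?case by (intro exI[of _ 1]) simp
  next
    case (Suc m)
    then obtain v where v: "v $ 0 = 1" and H: "fps_iterate h m = fps_X * v ^ q"
      and G: "fps_iterate g m = fps_const (\<gamma> ^ m) * fps_X * (v oo fps_X ^ q)" by blast
    define H G where "H = fps_iterate h m" and "G = fps_iterate g m"
    have H0: "H $ 0 = 0" and G0: "G $ 0 = 0"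
      by (simp_all add: H_def G_def H G)
    have "G ^ q = (fps_const ((\<gamma> ^ q) ^ m)) * fps_X ^ q * (v oo fps_X ^ q) ^ q"
      by (simp add: G_def G power_mult_distrib fps_const_power mult.commute flip: power_mult)
    also have "\<dots> = H oo fps_X ^ q"
      by (simp add: \<gamma> H_def H fps_compose_X_power_mult_distrib[OF q] fps_compose_power[OF X0] XX)
    finally have Gq: "G ^ q = H oo fps_X ^ q" .
    have "(u oo fps_X ^ q) oo G = u oo (G ^ q)"
      by (simp only: fps_compose_assoc[OF G0 X0, symmetric] fps_X_power_compose[OF G0])
    also have "\<dots> = (u oo H) oo fps_X ^ q"
      unfolding Gq by (rule fps_compose_assoc[OF X0 H0])
    finally have uG: "(u oo fps_X ^ q) oo G = (u oo H) oo fps_X ^ q" .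
    have "fps_iterate g (Suc m) = g oo G"
      by (simp only: fps_iterate_Suc G_def)
    also have "\<dots> = fps_const \<gamma> * G * ((u oo fps_X ^ q) oo G)"
      by (simp add: g fps_compose_mult_distrib G0)
    also have "\<dots> = fps_const (\<gamma> ^ Suc m) * fps_X * ((v * (u oo H)) oo fps_X ^ q)"
      unfolding uG fps_compose_X_power_mult_distrib[OF q]
      by (simp add: G_def G algebra_simps flip: fps_const_mult)
    finally have "fps_iterate g (Suc m) = \<dots>" .
    moreover have "fps_iterate h (Suc m) = fps_X * (v * (u oo H)) ^ q"
    proof -
      have "fps_iterate h (Suc m) = h oo H"
        by (simp only: fps_iterate_Suc H_def)
      also have "\<dots> = H * (u oo H) ^ q"
        by (simp add: h fps_compose_mult_distrib fps_compose_power H0)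
      finally have "fps_iterate h (Suc m) = H * (u oo H) ^ q" .
      then show ?thesis by (simp add: H_def H power_mult_distrib mult.assoc)
    qed
    moreover have "(v * (u oo H)) $ 0 = 1" by (simp add: v u)
    ultimately show ?case by blast
  qed
  then show ?thesis using that by blast
qed

text \<open>The cofactor of v - w in v^q - w^q has constant term q, hence is a unit.\<close>

lemma fps_X_power_dvd_root_diff:
  fixes v w :: "'a::field fps"
  assumes "v $ 0 = 1" "w $ 0 = 1" "of_nat q \<noteq> (0 :: 'a)" and "fps_X ^ N dvd v ^ q - w ^ q"
  shows "fps_X ^ N dvd v - w"
proof -
  define S where "S = (\<Sum>i<q. w ^ (q - Suc i) * v ^ i)"
  have "S $ 0 = (\<Sum>i<q. (w ^ (q - Suc i) * v ^ i) $ 0)"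
    by (simp add: S_def fps_sum_nth)
  also have "\<dots> = of_nat q" using assms(1,2) by (simp add: fps_power_zeroth)
  finally have "S dvd 1" using assms(3) by simp
  moreover have "v ^ q - w ^ q = (v - w) * S"
    unfolding S_def by (rule power_diff_sumr2)
  ultimately show ?thesis
    using assms(4) by (simp add: dvd_mult_unit_iff)
qed

lemma fps_X_power_dvd_compose_X_power:
  fixes D :: "'a::field fps"
  assumes "q \<ge> 1" "fps_X ^ N dvd D"
  shows "fps_X ^ (q * N) dvd D oo fps_X ^ q"
proof -
  from assms(2) obtain K where "D = fps_X ^ N * K" by blast
  then have "D oo fps_X ^ q = fps_X ^ (q * N) * (K oo fps_X ^ q)"
    using assms(1)
    by (simp add: fps_compose_X_power_mult_distrib fps_X_power_compose flip: power_mult)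
  then show ?thesis by simp
qed

text \<open>The number of iterations is a multiple of q, so the power of \<gamma> is 1. Of the order
  N + 1, one is due to the factor X; the remaining N is multiplied by q when X^q is
  substituted.\<close>

lemma fps_iterate_semiconjugate_dvd:
  fixes u :: "'a::field fps"
  assumes q: "q \<ge> 1" "of_nat q \<noteq> (0 :: 'a)" and \<gamma>: "\<gamma> ^ q = 1" and u: "u $ 0 = 1"
    and g: "g = fps_const \<gamma> * fps_X * (u oo fps_X ^ q)" and h: "h = fps_X * u ^ q"
    and w: "w $ 0 = 1" and dvd: "fps_X ^ (N + 1) dvd fps_iterate h (q * m) - fps_X * w ^ q"
  shows "fps_X ^ (q * N + 1) dvd fps_iterate g (q * m) - fps_X * (w oo fps_X ^ q)"
proof -
  obtain v where v: "v $ 0 = 1" "fps_iterate h (q * m) = fps_X * v ^ q"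
    "fps_iterate g (q * m) = fps_const (\<gamma> ^ (q * m)) * fps_X * (v oo fps_X ^ q)"
    using fps_iterate_semiconjugate[OF q(1) \<gamma> u g h] .
  have "fps_X ^ (1 + N) dvd fps_X ^ 1 * (v ^ q - w ^ q)"
    using dvd unfolding v(2) by (simp add: right_diff_distrib add.commute)
  then have "fps_X ^ N dvd v ^ q - w ^ q"
    unfolding fps_X_power_dvd_mult_cancel .
  then have "fps_X ^ N dvd v - w"
    using fps_X_power_dvd_root_diff v(1) w q(2) by blast
  then have "fps_X ^ (q * N) dvd (v - w) oo fps_X ^ q"
    by (rule fps_X_power_dvd_compose_X_power[OF q(1)])
  then have "fps_X ^ (1 + q * N) dvd fps_X ^ 1 * ((v oo fps_X ^ q) - (w oo fps_X ^ q))"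
    unfolding fps_X_power_dvd_mult_cancel fps_compose_sub_distrib .
  then show ?thesis
    unfolding v(3) power_mult \<gamma> by (simp add: right_diff_distrib add.commute)
qed

lemma quadratic_fps_compose_X_power:
  fixes x :: "'a::field"
  assumes "q \<ge> 1"
  shows "(1 + fps_X ^ e * quadratic_fps x y 0) oo fps_X ^ q
    = 1 + fps_const x * fps_X ^ (q * e) + fps_const y * fps_X ^ (q * e + q)"
  using assms
  by (simp add: fps_compose_add_distrib fps_compose_X_power_mult_distrib quadratic_fps_def
      fps_X_power_compose fps_X_fps_compose_startby0 power_add algebra_simps flip: power_mult)

text \<open>
  For \<open>e = 1\<close> the square of the first coefficient enters the second coefficient of the
  \<open>q\<close>-th power.
\<close>
lemma fps_iterate_semiconjugate_leading:
  fixes u :: "'a::field fps"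
  assumes q: "q \<ge> 1" "of_nat q \<noteq> (0 :: 'a)" and \<gamma>: "\<gamma> ^ q = 1" and u: "u $ 0 = 1"
    and g: "g = fps_const \<gamma> * fps_X * (u oo fps_X ^ q)" and h: "h = fps_X * u ^ q"
    and lead: "leading_terms (fps_iterate h (q * m)) e (of_nat q * x)
      (of_nat q * y + (if e = 1 then of_nat (q choose 2) * x\<^sup>2 else 0))"
    and e: "e \<ge> 1"
  shows "fps_X ^ (q * e + 2 * q + 1) dvd fps_iterate g (q * m)
    - fps_X * (1 + fps_const x * fps_X ^ (q * e) + fps_const y * fps_X ^ (q * e + q))"
proof -
  define w where "w = 1 + fps_X ^ e * quadratic_fps x y 0"
  define y' where "y' = of_nat q * y + (if e = 1 then of_nat (q choose 2) * x\<^sup>2 else 0)"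
  have w: "w $ 0 = 1" using e by (simp add: w_def)
  have "fps_X ^ (e + 2) dvd (w ^ q - 1) - fps_X ^ e * quadratic_fps (of_nat q * x) y' 0"
  proof (cases "e = 1")
    case True
    define R where "R = fps_X * quadratic_fps x y 0"
    have R: "R $ 0 = 0" "R $ 1 = x" "R $ 2 = y" by (simp_all add: R_def quadratic_fps_nth)
    have "e + 2 = 3" using True by simp
    then show ?thesis
      using one_plus_power_nth[OF R(1), of q] R
      unfolding fps_X_power_dvd_iff w_def True power_one_right R_def[symmetric] y'_def
      by (simp only: all_less_3_nat) (simp add: quadratic_fps_nth)
  next
    case False
    define R where "R = fps_X ^ e * quadratic_fps x y 0"
    have a: "fps_X ^ (e + e) dvd R\<^sup>2"
      unfolding power_add power2_eq_square R_def by (intro mult_dvd_mono) simp_all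
    have b: "fps_X ^ (e + 2) dvd (fps_X ^ (e + e) :: 'a fps)"
      using False e by (intro le_imp_power_dvd) simp
    have "fps_X ^ (e + 2) dvd (1 + R) ^ q - 1 - of_nat q * R"
      by (rule dvd_trans[OF dvd_trans[OF b a] one_plus_power_linear])
    moreover have "of_nat q * R = fps_X ^ e * quadratic_fps (of_nat q * x) y' 0"
      using False by (simp add: R_def y'_def quadratic_fps_def algebra_simps flip: fps_of_nat)
    ultimately show ?thesis unfolding w_def R_def[symmetric] by (simp only:)
  qed
  then have "leading_terms (fps_X * w ^ q) e (of_nat q * x) y'"
    using leading_terms_X_mult_iff[of "w ^ q - 1"] by simp
  then have "fps_X ^ (e + 2 + 1) dvd fps_iterate h (q * m) - fps_X * w ^ q"
    using dvd_diff[OF lead[unfolded leading_terms_def, folded y'_def]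
        \<open>leading_terms (fps_X * w ^ q) e _ y'\<close>[unfolded leading_terms_def]]
    by (simp add: numeral_eq_Suc)
  then have "fps_X ^ (q * (e + 2) + 1) dvd fps_iterate g (q * m) - fps_X * (w oo fps_X ^ q)"
    by (rule fps_iterate_semiconjugate_dvd[OF q \<gamma> u g h w])
  moreover have "q * (e + 2) + 1 = q * e + 2 * q + 1" by simp
  ultimately show ?thesis
    unfolding w_def quadratic_fps_compose_X_power[OF q(1)] by (simp only: add.assoc)
qed

section \<open>Iterates of order a power of the characteristic\<close>

lemma geometric_nat_div:
  fixes p :: nat
  assumes "p \<ge> 2"
  shows "(p ^ n - 1) div (p - 1) = (\<Sum>i<n. p ^ i)"
proof -
  have "int (p ^ n - 1) = int ((p - 1) * (\<Sum>i<n. p ^ i))"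
    using assms power_diff_1_eq[of "int p" n] by (simp add: of_nat_diff)
  then have "p ^ n - 1 = (p - 1) * (\<Sum>i<n. p ^ i)" by (simp only: of_nat_eq_iff)
  then show ?thesis using assms by simp
qed

lemma geometric_nat_Suc: "(\<Sum>i<Suc n. p ^ i) = p * (\<Sum>i<n. p ^ i) + (1 :: nat)"
  by (simp add: sum.lessThan_Suc_shift sum_distrib_left del: sum.lessThan_Suc)

text \<open>These sums are the exponents produced by e -> p e + 1; that they are 1 in the field is a
  hypothesis of \<open>leading_terms_iterate_CHAR\<close>.\<close>

lemma of_nat_geometric_CHAR:
  assumes "CHAR('a::comm_ring_1) = p"
  shows "of_nat (\<Sum>i<Suc n. p ^ i) = (1 :: 'a)"
  unfolding geometric_nat_Suc using of_nat_CHAR[where 'a = 'a] assms by simp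

text \<open>After the first step l = 0, and the coefficients evolve by (x, y) -> (-x^(p-1) y,
  -x^(p-2) y^2). This preserves monomials in \<open>A1\<close> and \<open>A1\<^sup>2 - A2\<close> up
  to sign, so the induction only adds up exponents. The bound s < p^n makes the subtractions in the
  exponents exact.\<close>

lemma leading_terms_iterate_CHAR_power_odd:
  fixes h :: "'a::field fps"
  assumes p: "prime p" "CHAR('a) = p" "odd p" and h: "leading_terms h 1 A1 A2" and n: "n \<ge> 1"
  defines "s \<equiv> \<Sum>i<n. p ^ i"
  shows "s < p ^ n \<and> leading_terms (fps_iterate h (p ^ n)) (\<Sum>i<Suc n. p ^ i)
    (A1 ^ (p ^ n - s) * (A1\<^sup>2 - A2) ^ s) (- (A1 ^ (p ^ n - s - 1) * (A1\<^sup>2 - A2) ^ (s + 1)))"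
  using n unfolding s_def
proof (induction n rule: nat_induct_at_least)
  case base
  have p2: "p \<noteq> 2" "p \<ge> 3" using p prime_ge_2_nat[OF p(1)] by (auto simp: le_less)
  have "leading_terms (fps_iterate h p) (p * 1 + 1) (- (A1 ^ (p - 1) * (A2 - 1 * A1\<^sup>2)))
      (- (A1 ^ (p - 2) * (A2 - 1 * A1\<^sup>2)\<^sup>2))"
    using leading_terms_iterate_CHAR[OF p(1,2) _ _ h, of 1] p2 by simp
  moreover have "- (A1 ^ (p - 1) * (A2 - 1 * A1\<^sup>2)) = A1 ^ (p - 1) * (A1\<^sup>2 - A2)"
    "(A2 - 1 * A1\<^sup>2)\<^sup>2 = (A1\<^sup>2 - A2)\<^sup>2"
    by (simp_all add: algebra_simps power2_commute)
  ultimately show ?case using p2 by (simp add: numeral_eq_Suc)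
next
  case (Suc n)
  define s where "s = (\<Sum>i<n. p ^ i)"
  define e where "e = (\<Sum>i<Suc n. p ^ i)"
  define B where "B = A1\<^sup>2 - A2"
  have p2: "p \<noteq> 2" "p \<ge> 3" using p prime_ge_2_nat[OF p(1)] by (auto simp: le_less)
  have "s < p ^ n" using Suc.IH by (simp add: s_def)
  \<comment> \<open>\<open>k\<close>, and \<open>r\<close> below, replace truncated subtractions by
    sums.\<close>
  define k where "k = p ^ n - s - 1"
  have k: "p ^ n = k + 1 + s" using \<open>s < p ^ n\<close> by (simp add: k_def)
  define r where "r = p - 2"
  have r: "p = r + 2" using p2(2) by (simp add: r_def)
  have IH: "leading_terms (fps_iterate h (p ^ n)) e (A1 ^ (k + 1) * B ^ s) (- (A1 ^ k * B ^ (s + 1)))"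
    using Suc.IH k by (simp add: s_def[symmetric] e_def[symmetric] B_def del: sum.lessThan_Suc)
  have "e \<ge> 3"
  proof -
    obtain n' where "n = Suc n'" using Suc.hyps by (cases n) auto
    then have "e = p * (\<Sum>i<n. p ^ i) + 1" "(\<Sum>i<n. p ^ i) \<ge> 1"
      unfolding e_def geometric_nat_Suc by (simp_all add: geometric_nat_Suc del: sum.lessThan_Suc)
    then show ?thesis using p2 mult_le_mono[of 3 p 1 "\<Sum>i<n. p ^ i"] by simp
  qed
  then have "leading_terms (fps_iterate (fps_iterate h (p ^ n)) p) (p * e + 1)
      (- ((A1 ^ (k + 1) * B ^ s) ^ (p - 1) * (- (A1 ^ k * B ^ (s + 1)))))
      (- ((A1 ^ (k + 1) * B ^ s) ^ (p - 2) * (- (A1 ^ k * B ^ (s + 1)))\<^sup>2))"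
    using leading_terms_iterate_CHAR[OF p(1,2) _ _ IH, of 0] p2 of_nat_geometric_CHAR[OF p(2), of n]
    by (simp add: e_def del: sum.lessThan_Suc)
  moreover have "fps_iterate (fps_iterate h (p ^ n)) p = fps_iterate h (p ^ Suc n)"
    by (simp add: fps_iterate_mult[OF leading_terms_nth_0[OF h], symmetric] mult.commute)
  moreover have "- ((A1 ^ (k + 1) * B ^ s) ^ (p - 1) * (- (A1 ^ k * B ^ (s + 1))))
      = A1 ^ (p * k + r + 1) * B ^ (p * s + 1)"
  proof -
    have idx: "p * k + r + 1 = (k + 1) * (p - 1) + k" "p * s + 1 = s * (p - 1) + (s + 1)"
      by (simp_all add: r algebra_simps)
    show ?thesis
      unfolding idx by (simp add: power_add power_mult power_mult_distrib)
  qed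
  moreover have "- ((A1 ^ (k + 1) * B ^ s) ^ (p - 2) * (- (A1 ^ k * B ^ (s + 1)))\<^sup>2)
      = - (A1 ^ (p * k + r) * B ^ (p * s + 2))"
  proof -
    have idx: "p * k + r = (k + 1) * (p - 2) + (k + k)" "p * s + 2 = s * (p - 2) + ((s + 1) + (s + 1))"
      by (simp_all add: r algebra_simps)
    show ?thesis
      unfolding idx by (simp add: power_add power_mult power_mult_distrib power2_eq_square)
  qed
  moreover have "p ^ Suc n = p * s + 1 + (p * k + r + 1)"
    unfolding power_Suc k by (simp add: r algebra_simps)
  moreover have "(\<Sum>i<Suc n. p ^ i) = p * s + 1" "(\<Sum>i<Suc (Suc n). p ^ i) = p * e + 1"
    unfolding s_def e_def by (rule geometric_nat_Suc)+
  ultimately show ?case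
    by (simp add: B_def del: sum.lessThan_Suc power_Suc)
qed

text \<open>In characteristic 2 the rule after the first step is (x, y) -> (x y, y^2): y is squared
  repeatedly, and x collects the factors y.\<close>

lemma leading_terms_iterate_CHAR_power_2:
  fixes h :: "'a::field fps"
  assumes p: "CHAR('a) = 2" and h: "leading_terms h 1 A1 A2" and n: "n \<ge> 1"
  shows "leading_terms (fps_iterate h (2 ^ n)) (\<Sum>i<Suc n. 2 ^ i)
    (A1 * A2 ^ (2 ^ (n - 1) - 1) * (A1\<^sup>2 - A2) ^ 2 ^ (n - 1))
    (A2 ^ 2 ^ (n - 1) * (A1\<^sup>2 - A2) ^ 2 ^ (n - 1))"
  using n
proof (induction n rule: nat_induct_at_least)
  case base
  have "2 = (0 :: 'a)" using of_nat_CHAR[where 'a = 'a] p by simp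
  then have m: "- x = x" for x :: 'a
    by (metis eq_neg_iff_add_eq_0 mult_2 mult_zero_left)
  have "leading_terms (fps_iterate h 2) (2 * 1 + 1) (- (A1 ^ 1 * (A2 - 1 * A1\<^sup>2))) (A2 * (A2 - 1 * A1\<^sup>2))"
    using leading_terms_iterate_CHAR[OF two_is_prime_nat p _ _ h, of 1] by simp
  moreover have "- (A1 ^ 1 * (A2 - 1 * A1\<^sup>2)) = A1 * (A1\<^sup>2 - A2)"
    by (simp add: algebra_simps)
  moreover have "A2 * (A2 - 1 * A1\<^sup>2) = A2 * (A1\<^sup>2 - A2)"
    using m[of "A2 * (A1\<^sup>2 - A2)"] by (simp add: algebra_simps)
  ultimately have "leading_terms (fps_iterate h 2) (2 * 1 + 1) (A1 * (A1\<^sup>2 - A2)) (A2 * (A1\<^sup>2 - A2))"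
    by (simp only:)
  then show ?case by (simp add: numeral_eq_Suc)
next
  case (Suc n)
  define e where "e = (\<Sum>i<Suc n. 2 ^ i :: nat)"
  define B where "B = A1\<^sup>2 - A2"
  have "2 = (0 :: 'a)" using of_nat_CHAR[where 'a = 'a] p by simp
  then have m: "- x = x" for x :: 'a
    by (metis eq_neg_iff_add_eq_0 mult_2 mult_zero_left)
  define k where "k = (2 :: nat) ^ (n - 1) - 1"
  have k: "2 ^ (n - 1) = k + 1" by (simp add: k_def)
  have k': "2 ^ n = 2 * (k + 1)" using Suc.hyps k by (cases n) simp_all
  have IH: "leading_terms (fps_iterate h (2 ^ n)) e (A1 * A2 ^ k * B ^ (k + 1)) (A2 ^ (k + 1) * B ^ (k + 1))"
    using Suc.IH unfolding e_def[symmetric] B_def[symmetric] k by simp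
  have "e \<ge> 3"
  proof -
    obtain n' where "n = Suc n'" using Suc.hyps by (cases n) auto
    then show ?thesis
      unfolding e_def geometric_nat_Suc by (simp add: geometric_nat_Suc del: sum.lessThan_Suc)
  qed
  then have "leading_terms (fps_iterate (fps_iterate h (2 ^ n)) 2) (2 * e + 1)
      (- ((A1 * A2 ^ k * B ^ (k + 1)) ^ 1 * (A2 ^ (k + 1) * B ^ (k + 1))))
      ((A2 ^ (k + 1) * B ^ (k + 1)) * (A2 ^ (k + 1) * B ^ (k + 1)))"
    using leading_terms_iterate_CHAR[OF two_is_prime_nat p _ _ IH, of 0] of_nat_geometric_CHAR[OF p, of n]
    by (simp add: e_def del: sum.lessThan_Suc power_Suc)
  moreover have "fps_iterate (fps_iterate h (2 ^ n)) 2 = fps_iterate h (2 ^ Suc n)"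
    by (simp add: fps_iterate_mult[OF leading_terms_nth_0[OF h], symmetric] mult.commute)
  moreover have "- ((A1 * A2 ^ k * B ^ (k + 1)) ^ 1 * (A2 ^ (k + 1) * B ^ (k + 1)))
      = A1 * A2 ^ (2 ^ n - 1) * B ^ 2 ^ n"
    unfolding m k' by (simp add: algebra_simps power_mult power2_eq_square power_add)
  moreover have "(A2 ^ (k + 1) * B ^ (k + 1)) * (A2 ^ (k + 1) * B ^ (k + 1)) = A2 ^ 2 ^ n * B ^ 2 ^ n"
    unfolding k' by (simp only: power_mult power2_eq_square power_mult_distrib mult_ac)
  moreover have "(\<Sum>i<Suc (Suc n). 2 ^ i) = 2 * e + (1 :: nat)"
    unfolding e_def by (rule geometric_nat_Suc)
  ultimately show ?case
    by (simp add: B_def del: sum.lessThan_Suc power_Suc)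
qed

text \<open>Frobenius is additive and fixes 1, hence every integer. This collapses the power of q
  that accumulates in the coefficients.\<close>

lemma of_nat_power_CHAR_power:
  assumes "prime p" "CHAR('a::comm_ring_1) = p"
  shows "(of_nat q :: 'a) ^ (p ^ n) = of_nat q"
proof (induction q)
  case 0
  then show ?case using prime_gt_0_nat[OF assms(1)] by (simp add: zero_power)
next
  case (Suc q)
  then show ?case
    using freshmans_dream'[of "p ^ n" n "1 :: 'a" "of_nat q"] assms by simp
qed

text \<open>
  With \<open>K = (q - 1) / 2\<close>, all the half-integers involved are polynomials in \<open>K\<close> with integer
  coefficients, which treats characteristic \<open>2\<close> and odd characteristic uniformly.
\<close>
lemma half_eqs:
  assumes p: "prime p" "CHAR('a::field) = p" and q: "q \<ge> 1" "\<not> p dvd q"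
  obtains K :: "'a::field" where "of_nat q = 2 * K + 1" "half p (q - 1) = K" "half p (q + 1) = K + 1"
    "half p (q\<^sup>2 - 1) = 2 * K * (K + 1)" "of_nat (q choose 2) = (2 * K + 1) * K"
proof (cases "p = 2")
  case True
  then obtain k where k: "q = 2 * k + 1" using q(2) oddE by blast
  have "q choose 2 = (2 * k + 1) * k"
    unfolding choose_two k by simp
  moreover have "(q\<^sup>2 - 1) div 2 = 2 * k * (k + 1)"
    by (simp add: k power2_eq_square algebra_simps)
  ultimately show ?thesis
    using True k by (intro that[of "of_nat k"]) (simp_all add: half_def algebra_simps)
next
  case False
  then have "\<not> p dvd 2" using p(1) primes_dvd_imp_eq two_is_prime_nat by blast
  then have 2: "(2 :: 'a) \<noteq> 0"
    using of_nat_eq_0_iff_char_dvd[of 2, where 'a = 'a] p(2) by simp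
  define K :: 'a where "K = (of_nat q - 1) / 2"
  have K: "of_nat q = 2 * K + 1" using 2 by (simp add: K_def field_simps)
  have "of_nat (q\<^sup>2 - 1) = (of_nat q ^ 2 - 1 :: 'a)" using q(1) by (simp add: of_nat_diff)
  also have "\<dots> = 2 * (2 * K * (K + 1))" by (simp add: K power2_eq_square algebra_simps)
  finally have q2: "half p (q\<^sup>2 - 1) = 2 * K * (K + 1)" using False 2 by (simp add: half_def)
  have "2 * of_nat (q choose 2) = 2 * ((2 * K + 1) * K)"
    unfolding two_mult_choose_two K by simp
  then have "of_nat (q choose 2) = (2 * K + 1) * K" using 2 by simp
  then show ?thesis
    using K q2 False q(1) 2 by (intro that[of K]) (simp_all add: half_def of_nat_diff field_simps)
qed

section \<open>The two congruences for g\<close>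

theorem mainTheorem6:
  fixes p q :: nat and \<gamma> :: "'k::field" and a :: "nat \<Rightarrow> 'k" and g :: "'k fps"
  assumes "prime p" and "CHAR('k) = p"
    and "q \<ge> 1" and "\<not> p dvd q"
    and "\<gamma> ^ q = 1"
    and "g = fps_const \<gamma> * fps_X * (1 + (\<Sum>j. fps_const (a (Suc j)) * fps_X ^ (Suc j * q)))"
  shows "fps_X ^ (3 * q + 1) dvd
           fps_iterate g q
           - fps_X * (1 + fps_const (of_nat q * a 1) * fps_X ^ q
               + fps_const (of_nat q * (half p (q\<^sup>2 - 1) * (a 1)\<^sup>2 + a 2)) * fps_X ^ (2 * q))
       \<and> (\<forall>n\<ge>1. fps_X ^ (q * ((p ^ (n + 1) - 1) div (p - 1)) + 2 * q + 1) dvd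
           fps_iterate g (q * p ^ n)
           - fps_X * (1 + fps_const (chi p q n (a 1) (a 2))
                            * fps_X ^ (q * ((p ^ (n + 1) - 1) div (p - 1)))
               + fps_const (xi p q n (a 1) (a 2))
                            * fps_X ^ (q * ((p ^ (n + 1) - 1) div (p - 1)) + q)))"
proof -
  note p = assms(1,2) and q = assms(3,4)
  \<comment> \<open>Chosen so that g is \<gamma> X times u at X^q; the constant term is 1, whatever
    \<open>a 0\<close> is.\<close>
  define u where "u = Abs_fps (\<lambda>i. if i = 0 then 1 else a i)"
  define h where "h = fps_X * u ^ q"
  have u: "u $ 0 = 1" "u $ 1 = a 1" "u $ 2 = a 2" by (simp_all add: u_def)
  have g: "g = fps_const \<gamma> * fps_X * (u oo fps_X ^ q)"
  proof -
    have "(\<Sum>j. fps_const (a (Suc j)) * fps_X ^ (Suc j * q))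
        = Abs_fps (\<lambda>i. if i > 0 \<and> q dvd i then a (i div q) else 0)"
      using sums_fps_X_power_multiples[OF q(1)] by (rule sums_unique[symmetric])
    then have "1 + (\<Sum>j. fps_const (a (Suc j)) * fps_X ^ (Suc j * q)) = u oo fps_X ^ q"
      using q(1) by (auto simp: fps_eq_iff fps_nth_compose_X_power u_def)
    then show ?thesis using assms(6) by simp
  qed
  have q0: "of_nat q \<noteq> (0 :: 'k)"
    using of_nat_eq_0_iff_char_dvd[of q, where 'a = 'k] p(2) q(2) by simp
  note transfer = fps_iterate_semiconjugate_leading[OF q(1) q0 assms(5) u(1) g h_def]
  obtain K :: 'k where K: "of_nat q = 2 * K + 1" "half p (q - 1) = K" "half p (q + 1) = K + 1"
    "half p (q\<^sup>2 - 1) = 2 * K * (K + 1)" "of_nat (q choose 2) = (2 * K + 1) * K"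
    using half_eqs[OF p q] .
  define Q where "Q = 2 * K + 1"
  define b where "b = (K + 1) * (a 1)\<^sup>2 - a 2"
  \<comment> \<open>\<open>A1\<close> and \<open>A2\<close> are the coefficients of X^2 and X^3 in
    \<open>h\<close>, namely q a_1 and q a_2 + (q choose 2) a_1^2, written with K.\<close>
  define A1 where "A1 = Q * a 1"
  define A2 where "A2 = Q * (a 2 + K * (a 1)\<^sup>2)"
  have B: "A1\<^sup>2 - A2 = Q * b"
    by (simp add: A1_def A2_def b_def Q_def power2_eq_square algebra_simps)
  have h: "leading_terms h 1 A1 A2"
  proof -
    define R where "R = u - 1"
    have R: "R $ 0 = 0" "R $ 1 = a 1" "R $ 2 = a 2" and uR: "u = 1 + R"
      using u by (simp_all add: R_def)
    show ?thesis
      unfolding leading_terms_1_iff h_def uR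
      using one_plus_power_nth[OF R(1), of q] R
      by (simp add: fps_X_mult_nth A1_def A2_def Q_def K(1,5) power2_eq_square algebra_simps)
  qed
  have "leading_terms (fps_iterate h (q * 1)) 1 (of_nat q * A1)
      (of_nat q * A2 + of_nat q * (of_nat q - 1) * A1\<^sup>2)"
    using leading_terms_iterate_1[OF h, of q] by simp
  \<comment> \<open>This is the shape that \<open>transfer\<close> demands for e = 1 and x = q a_1,
    with its conditional left in place.\<close>
  moreover have "of_nat q * A2 + of_nat q * (of_nat q - 1) * A1\<^sup>2
      = of_nat q * (of_nat q * (half p (q\<^sup>2 - 1) * (a 1)\<^sup>2 + a 2))
        + (if (1 :: nat) = 1 then of_nat (q choose 2) * (of_nat q * a 1)\<^sup>2 else 0)"
    unfolding K A1_def A2_def Q_def by (simp add: power2_eq_square algebra_simps)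
  ultimately have "leading_terms (fps_iterate h (q * 1)) 1 (of_nat q * (of_nat q * a 1))
      (of_nat q * (of_nat q * (half p (q\<^sup>2 - 1) * (a 1)\<^sup>2 + a 2))
        + (if (1 :: nat) = 1 then of_nat (q choose 2) * (of_nat q * a 1)\<^sup>2 else 0))"
    by (simp only: A1_def Q_def K(1))
  note first = transfer[OF this le_refl]
  have "fps_X ^ (q * (\<Sum>i<Suc n. p ^ i) + 2 * q + 1) dvd fps_iterate g (q * p ^ n)
      - fps_X * (1 + fps_const (chi p q n (a 1) (a 2)) * fps_X ^ (q * (\<Sum>i<Suc n. p ^ i))
          + fps_const (xi p q n (a 1) (a 2)) * fps_X ^ (q * (\<Sum>i<Suc n. p ^ i) + q))"
    if n: "n \<ge> 1" for n
  proof -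
    define s where "s = (\<Sum>i<n. p ^ i)"
    define e where "e = (\<Sum>i<Suc n. p ^ i)"
    have s: "(p ^ n - 1) div (p - 1) = s"
      unfolding s_def using geometric_nat_div prime_ge_2_nat[OF p(1)] by blast
    have e: "e \<ge> 2"
    proof -
      have "e = p * s + 1" unfolding e_def s_def by (rule geometric_nat_Suc)
      moreover have "s > 0" using n prime_gt_0_nat[OF p(1)] by (cases n) (simp_all add: s_def)
      ultimately show ?thesis using prime_gt_0_nat[OF p(1)] by simp
    qed
    \<comment> \<open>No factor q appears here: the q-fold iteration below multiplies both
      coefficients by q, and extracting the q-th root removes that factor again.\<close>
    have "leading_terms (fps_iterate h (p ^ n)) e (chi p q n (a 1) (a 2)) (xi p q n (a 1) (a 2))"
    proof (cases "p = 2")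
      case False
      then have odd: "odd p" using p(1) prime_odd_nat prime_ge_2_nat[OF p(1)] by simp
      have *: "s < p ^ n" and lead: "leading_terms (fps_iterate h (p ^ n)) e
          (A1 ^ (p ^ n - s) * (Q * b) ^ s) (- (A1 ^ (p ^ n - s - 1) * (Q * b) ^ (s + 1)))"
        using leading_terms_iterate_CHAR_power_odd[OF p odd h n] unfolding s_def e_def B by blast+
      have Qp: "Q ^ (p ^ n) = Q"
        using of_nat_power_CHAR_power[OF p, of q n] by (simp only: K(1) Q_def)
      \<comment> \<open>The exponents of Q coming from \<open>A1\<close> and from
        \<open>Q * b\<close> add up to p^n, and Q^(p^n) = Q.\<close>
      have "A1 ^ (p ^ n - s) * (Q * b) ^ s = Q ^ (p ^ n - s + s) * (a 1 ^ (p ^ n - s) * b ^ s)"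
        by (simp add: A1_def power_mult_distrib power_add)
      also have "p ^ n - s + s = p ^ n" using * by simp
      finally have chi: "A1 ^ (p ^ n - s) * (Q * b) ^ s = chi p q n (a 1) (a 2)"
        unfolding Qp chi_def s K(1,3) using odd by (simp add: Q_def b_def mult.assoc)
      have "A1 ^ (p ^ n - s - 1) * (Q * b) ^ (s + 1)
          = Q ^ (p ^ n - s - 1 + (s + 1)) * (a 1 ^ (p ^ n - s - 1) * b ^ (s + 1))"
        by (simp add: A1_def power_mult_distrib power_add)
      also have "p ^ n - s - 1 + (s + 1) = p ^ n" using * by simp
      finally have "A1 ^ (p ^ n - s - 1) * (Q * b) ^ (s + 1)
          = Q * (a 1 ^ (p ^ n - s - 1) * b ^ (s + 1))"
        unfolding Qp .
      moreover have "xi p q n (a 1) (a 2) = - (Q * (a 1 ^ (p ^ n - s - 1) * b ^ (s + 1)))"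
        unfolding xi_def s K(1,3) Q_def b_def if_P[OF odd] by (simp only: mult_minus_left mult.assoc)
      ultimately show ?thesis
        using lead chi by (simp only:)
    next
      case True
      have 2: "2 = (0 :: 'k)" using of_nat_CHAR[where 'a = 'k] p(2) True by simp
      then have m: "x - y = x + y" for x y :: 'k
        by (metis diff_conv_add_uminus eq_neg_iff_add_eq_0 mult_2 mult_zero_left)
      have Q: "Q = 1" by (simp add: Q_def 2)
      have A: "A1 = a 1" "A2 = K * (a 1)\<^sup>2 - a 2"
        by (simp_all add: A1_def A2_def Q m)
      have "leading_terms (fps_iterate h (p ^ n)) e
          (a 1 * (K * (a 1)\<^sup>2 - a 2) ^ (2 ^ (n - 1) - 1) * b ^ 2 ^ (n - 1))
          (A2 ^ 2 ^ (n - 1) * b ^ 2 ^ (n - 1))"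
        using leading_terms_iterate_CHAR_power_2[OF p(2)[unfolded True] h n] B
        unfolding e_def True Q A by simp
      \<comment> \<open>For n = 1 the exponent \<open>2 ^ (n - 1) - 1\<close> is 0, so one formula
        covers both clauses of \<open>chi\<close> for p = 2.\<close>
      moreover have "a 1 * (K * (a 1)\<^sup>2 - a 2) ^ (2 ^ (n - 1) - 1) * b ^ 2 ^ (n - 1)
          = chi p q n (a 1) (a 2)"
        unfolding chi_def K b_def using True by simp
      moreover have "A2 ^ 2 ^ (n - 1) * b ^ 2 ^ (n - 1) = xi p q n (a 1) (a 2)"
      proof -
        \<comment> \<open>K is the image of (q - 1) / 2, and a product of consecutive integers is
          even. This removes K from \<open>xi\<close>.\<close>
        have "K * (K + 1) = 0"
        proof -
          have "K = half 2 (q - 1)" using K(2) True by simp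
          then have "K = of_nat ((q - 1) div 2)" by (simp add: half_def)
          then have "K * (K + 1) = of_nat ((q - 1) div 2 * ((q - 1) div 2 + 1))"
            by (simp add: algebra_simps)
          moreover have "p dvd (q - 1) div 2 * ((q - 1) div 2 + 1)" using True by simp
          ultimately show ?thesis using of_nat_eq_0_iff_char_dvd p(2) by metis
        qed
        moreover have "A2 * b = a 2 * ((a 1)\<^sup>2 - a 2)
            + (K * (K + 1) * (a 1) ^ 4 + 2 * (K * (a 1)\<^sup>2 * a 2))"
          unfolding A b_def m by (simp add: algebra_simps power2_eq_square power4_eq_xxxx)
        ultimately have "A2 * b = a 2 * ((a 1)\<^sup>2 - a 2)" by (simp add: 2)
        then show ?thesis
          unfolding xi_def using True by (simp flip: power_mult_distrib)
      qed
      ultimately show ?thesis by (simp only:)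
    qed
    then have "leading_terms (fps_iterate (fps_iterate h (p ^ n)) q) e
        (of_nat q * chi p q n (a 1) (a 2)) (of_nat q * xi p q n (a 1) (a 2))"
      by (rule leading_terms_iterate[OF e])
    then have "leading_terms (fps_iterate h (q * p ^ n)) e (of_nat q * chi p q n (a 1) (a 2))
        (of_nat q * xi p q n (a 1) (a 2)
          + (if e = 1 then of_nat (q choose 2) * (chi p q n (a 1) (a 2))\<^sup>2 else 0))"
      using e by (simp add: fps_iterate_mult[OF leading_terms_nth_0[OF h], symmetric] mult.commute)
    then show ?thesis
      unfolding e_def[symmetric] using e by (intro transfer) simp_all
  qed
  note second = this
  have geometric: "(p ^ (n + 1) - 1) div (p - 1) = (\<Sum>i<Suc n. p ^ i)" for n
    using geometric_nat_div[OF prime_ge_2_nat[OF p(1)], of "Suc n"] by (simp only: Suc_eq_plus1)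
  have idx: "q + 2 * q + 1 = 3 * q + 1" "q + q = 2 * q" by simp_all
  show ?thesis
    unfolding geometric
    using first[unfolded mult_1_right idx] second by blast
qed

end
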